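(* Let $N\ge 1$ and let $\Omega\subseteq\mathbb{R}^N$ be a nonempty, open and bounded set. There exists a constant $c(\Omega)>0$, depending only on $\Omega$, such that for every real number $L\ge 1$ one has $$h(\Omega)+\frac{c(\Omega)}{L}\;\le\; h(\Omega_L)\;\le\; h(\Omega)+\frac{2}{L},$$ where $\Omega_L:=\Omega\times(0,L)\subseteq\mathbb{R}^{N+1}$.
   Context: For a nonempty open and bounded set $A\subseteq\mathbb{R}^M$ ($M\ge 1$), the Cheeger constant of $A$ is $$h(A):=\inf\left\{\frac{P(E)}{|E|}\,:\,E\subseteq A \text{ measurable},\ |E|>0\right\},$$ where $|E|$ is the $M$-dimensional Lebesgue measure of $E$ and $P(E)$ is the (De Giorgi) perimeter of $E$ in the whole space $\mathbb{R}^M$ (equal to $+\infty$ if $E$ does not have finite perimeter). Thus $h(\Omega)$ is computed in $\mathbb{R}^N$ and $h(\Omega_L)$ in $\mathbb{R}^{N+1}$. *)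

theory Defs
  imports "HOL-Analysis.Analysis"
begin

(* In finite dimension, a differentiable map is C^1 iff its partial derivatives are continuous. *)
definition C1_compact_support :: "('a::euclidean_space \<Rightarrow> 'a) \<Rightarrow> bool" where
  "C1_compact_support \<phi> \<longleftrightarrow>
     (\<forall>x. \<phi> differentiable (at x)) \<and>
     (\<forall>b\<in>Basis. continuous_on UNIV (\<lambda>x. frechet_derivative \<phi> (at x) b)) \<and>
     compact (closure {x. \<phi> x \<noteq> 0})"

definition divergence :: "('a::euclidean_space \<Rightarrow> 'a) \<Rightarrow> 'a \<Rightarrow> real" where
  "divergence \<phi> x = (\<Sum>b\<in>Basis. frechet_derivative \<phi> (at x) b \<bullet> b)"

(* De Giorgi perimeter in the whole space. For measurable E of finite measure it is infinite
   exactly when E does not have finite perimeter. *)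
definition perimeter :: "'a::euclidean_space set \<Rightarrow> ereal" where
  "perimeter E =
     (SUP \<phi>\<in>{\<phi>. C1_compact_support \<phi> \<and> (\<forall>x. norm (\<phi> x) \<le> 1)}.
        ereal (LINT x:E|lebesgue. divergence \<phi> x))"

(* Intended for bounded A: then every competitor E has finite measure, so that the
   real-valued measure is its Lebesgue measure. *)
definition cheeger :: "'a::euclidean_space set \<Rightarrow> ereal" where
  "cheeger A =
     (INF E\<in>{E. E \<subseteq> A \<and> E \<in> sets lebesgue \<and> measure lebesgue E > 0}.
        perimeter E / ereal (measure lebesgue E))"

end

theory Submission
  imports Defs
begin

text \<open>
  The upper bound comes from the competitors \<open>E \<times> (0, L)\<close>, whose perimeter is at most
  \<open>L P(E) + 2 \<bar>E\<bar>\<close> (lemma \<open>perimeter_cylinder\<close>).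

  For the lower bound, let \<open>F\<close> be a competitor in the cylinder and \<open>m t\<close> the measure of its
  horizontal slice at height \<open>t\<close>. Testing only with horizontal fields gives \<open>P(F) \<ge> h(\<Omega>) \<bar>F\<bar>\<close>; the
  problem is to gain a further constant times \<open>\<bar>F\<bar> / L\<close>. The naive combination of horizontal and vertical
  perimeter, \<open>P(F)\<^sup>2 \<ge> (h \<bar>F\<bar>)\<^sup>2 + (2 \<bar>F\<bar> / L)\<^sup>2\<close>, gains only the order \<open>1 / L\<^sup>2\<close>, because tilting the test
  field everywhere costs as much as it earns. The gain must be localised where the slices are small.
  Sets \<open>E\<close> of measure at most some \<open>\<delta>\<close> satisfy \<open>P(E) \<ge> 2 h(\<Omega>) \<bar>E\<bar>\<close>
  (\<open>small_sets_large_perimeter\<close>), so while \<open>m \<le> \<delta>\<close> the horizontal field may be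
  multiplied by \<open>3/4\<close> without losing \<open>h(\<Omega>) m\<close>, and this leaves room for a vertical component of
  size \<open>1/2\<close>. Turning this component off where \<open>m\<close> first exceeds \<open>\<delta>' \<le> \<delta>\<close> earns \<open>\<delta>' / 2\<close>
  (\<open>perimeter_lower_bound_by_fibers\<close>). Since \<open>m\<close> exceeds half its average \<open>\<bar>F\<bar> / L\<close> somewhere, \<open>\<delta>'\<close>
  can be taken proportional to \<open>\<bar>F\<bar> / L\<close> (\<open>cheeger_cylinder_ge\<close>).

  Everything is done on the dual side, by exhibiting explicit test fields, so that no structure theory
  of sets of finite perimeter enters. The remaining difficulty is that the horizontal field must be
  nearly optimal for almost every slice and yet continuously differentiable in \<open>t\<close>. This is
  resolved by a countable family of fields that computes the perimeter of all Borel subsets of \<open>\<Omega>\<close>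
  (\<open>countable_test_fields\<close>) and by gluing finitely many of them along the axis
  (\<open>selected_test_fields\<close>).
\<close>

section \<open>Continuously differentiable maps and the divergence\<close>

text \<open>
  The derivative is required to be continuous in each direction separately, the form in which it
  can be verified componentwise.
\<close>

definition C1 :: "('a::euclidean_space \<Rightarrow> 'b::euclidean_space) \<Rightarrow> bool" where
  "C1 f \<longleftrightarrow> (\<exists>f'. (\<forall>x. (f has_derivative f' x) (at x)) \<and> (\<forall>v. continuous_on UNIV (\<lambda>x. f' x v)))"

lemma C1I:
  assumes "\<And>x. (f has_derivative f' x) (at x)" "\<And>v. continuous_on UNIV (\<lambda>x. f' x v)"
  shows "C1 f"
  using assms unfolding C1_def by blast

lemma C1_frechet:
  assumes "C1 f"
  shows "(f has_derivative frechet_derivative f (at x)) (at x)"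
    and "continuous_on UNIV (\<lambda>x. frechet_derivative f (at x) v)"
proof -
  obtain f' where f': "\<And>x. (f has_derivative f' x) (at x)" "\<And>v. continuous_on UNIV (\<lambda>x. f' x v)"
    using assms unfolding C1_def by blast
  have eq: "frechet_derivative f (at x) = f' x" for x
    using f'(1) frechet_derivative_at by metis
  show "(f has_derivative frechet_derivative f (at x)) (at x)"
    using f'(1) eq by simp
  show "continuous_on UNIV (\<lambda>x. frechet_derivative f (at x) v)"
    using f'(2) eq by simp
qed

lemma C1_continuous: "C1 f \<Longrightarrow> continuous_on S f"
  by (meson C1_frechet(1) continuous_at_imp_continuous_on has_derivative_continuous)

text \<open>
  Continuity of a derivative in each fixed direction already gives joint continuity, because
  the derivative is linear and the space is finite-dimensional. This is what makes the definition
  of \<open>C1\<close> closed under composition, and what reconciles it with continuous partial derivatives.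
\<close>

lemma continuous_derivative_along:
  fixes f' :: "'a::topological_space \<Rightarrow> 'b::euclidean_space \<Rightarrow> 'c::real_normed_vector"
  assumes "\<And>x. linear (f' x)" "\<And>b. b \<in> Basis \<Longrightarrow> continuous_on UNIV (\<lambda>x. f' x b)"
    and "continuous_on UNIV w"
  shows "continuous_on UNIV (\<lambda>x. f' x (w x))"
proof -
  have "f' x (w x) = (\<Sum>b\<in>Basis. (w x \<bullet> b) *\<^sub>R f' x b)" for x
    using assms(1)[of x] linear_sum[OF assms(1), of x "\<lambda>b. (w x \<bullet> b) *\<^sub>R b" Basis]
    by (simp add: euclidean_representation linear_scale)
  then show ?thesis
    using assms by (auto intro!: continuous_intros)
qed

lemma C1_compact_support_iff:
  "C1_compact_support \<phi> \<longleftrightarrow> C1 \<phi> \<and> compact (closure {x. \<phi> x \<noteq> 0})" (is "?l \<longleftrightarrow> ?r")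
proof
  assume l: ?l
  then have d: "(\<phi> has_derivative frechet_derivative \<phi> (at x)) (at x)" for x
    using C1_compact_support_def frechet_derivative_works by blast
  have "continuous_on UNIV (\<lambda>x. frechet_derivative \<phi> (at x) v)" for v
    by (rule continuous_derivative_along[where w = "\<lambda>x. v"])
      (use l d in \<open>auto simp: C1_compact_support_def intro: has_derivative_linear\<close>)
  with l d show ?r
    by (auto simp: C1_compact_support_def intro: C1I[of \<phi> "\<lambda>x. frechet_derivative \<phi> (at x)"])
next
  assume r: ?r
  then show ?l
    using C1_frechet differentiableI unfolding C1_compact_support_def by metis
qed

lemma C1_const: "C1 (\<lambda>x. c)"
  by (rule C1I[where f' = "\<lambda>_ _. 0"]) auto

lemma C1_bounded_linear: "bounded_linear f \<Longrightarrow> C1 f"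
  by (rule C1I[where f' = "\<lambda>_. f"]) (auto simp: bounded_linear_imp_has_derivative)

lemma C1_add: "C1 f \<Longrightarrow> C1 g \<Longrightarrow> C1 (\<lambda>x. f x + g x)"
  by (rule C1I[where f' = "\<lambda>x v. frechet_derivative f (at x) v + frechet_derivative g (at x) v"])
    (auto intro!: has_derivative_add continuous_on_add C1_frechet)

lemma C1_diff: "C1 f \<Longrightarrow> C1 g \<Longrightarrow> C1 (\<lambda>x. f x - g x)"
  by (rule C1I[where f' = "\<lambda>x v. frechet_derivative f (at x) v - frechet_derivative g (at x) v"])
    (auto intro!: has_derivative_diff continuous_on_diff C1_frechet)

lemma C1_scaleR: "C1 f \<Longrightarrow> C1 g \<Longrightarrow> C1 (\<lambda>x. f x *\<^sub>R g x)"
  by (rule C1I[where f' = "\<lambda>x v. f x *\<^sub>R frechet_derivative g (at x) v + frechet_derivative f (at x) v *\<^sub>R g x"])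
    (auto intro!: has_derivative_scaleR continuous_on_add continuous_on_scaleR C1_frechet intro: C1_continuous)

lemma C1_mult: "C1 f \<Longrightarrow> C1 g \<Longrightarrow> C1 (\<lambda>x. f x * g x :: real)"
  using C1_scaleR[of f g] by simp

lemma C1_sum: "finite I \<Longrightarrow> (\<And>i. i \<in> I \<Longrightarrow> C1 (f i)) \<Longrightarrow> C1 (\<lambda>x. \<Sum>i\<in>I. f i x)"
  by (induction I rule: finite_induct) (auto intro: C1_const C1_add)

lemma C1_compose:
  assumes "C1 f" "C1 g"
  shows "C1 (\<lambda>x. f (g x))"
proof (rule C1I[where f' = "\<lambda>x v. frechet_derivative f (at (g x)) (frechet_derivative g (at x) v)"])
  fix x v
  show "((\<lambda>x. f (g x)) has_derivative (\<lambda>v. frechet_derivative f (at (g x)) (frechet_derivative g (at x) v))) (at x)"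
    using has_derivative_compose[OF C1_frechet(1)[OF assms(2)] C1_frechet(1)[OF assms(1)]] .
  show "continuous_on UNIV (\<lambda>x. frechet_derivative f (at (g x)) (frechet_derivative g (at x) v))"
  proof (rule continuous_derivative_along[where f' = "\<lambda>x. frechet_derivative f (at (g x))"])
    show "linear (frechet_derivative f (at (g x)))" for x
      using C1_frechet(1)[OF assms(1)] has_derivative_linear by blast
    show "continuous_on UNIV (\<lambda>x. frechet_derivative f (at (g x)) b)" for b
      by (rule continuous_on_compose2[OF C1_frechet(2)[OF assms(1)] C1_continuous[OF assms(2)]]) auto
  qed (rule C1_frechet(2)[OF assms(2)])
qed

lemma C1_Pair:
  assumes "C1 f" "C1 g"
  shows "C1 (\<lambda>x. (f x, g x))"
  by (rule C1I[where f' = "\<lambda>x v. (frechet_derivative f (at x) v, frechet_derivative g (at x) v)"])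
    (auto intro!: has_derivative_Pair continuous_on_Pair C1_frechet assms)

lemma C1_id: "C1 (\<lambda>x. x)"
  by (simp add: C1_bounded_linear bounded_linear_ident)

lemmas C1_fst = C1_bounded_linear[OF bounded_linear_fst]
lemmas C1_snd = C1_bounded_linear[OF bounded_linear_snd]

lemma C1_real:
  fixes f :: "real \<Rightarrow> real"
  assumes "\<And>x. (f has_real_derivative f' x) (at x)" "continuous_on UNIV f'"
  shows "C1 f"
  by (rule C1I[where f' = "\<lambda>x v. f' x * v"])
    (use assms in \<open>auto simp: has_field_derivative_def intro!: continuous_intros\<close>)

lemma C1_real_deriv:
  fixes f :: "real \<Rightarrow> real"
  assumes "C1 f"
  shows "(f has_real_derivative deriv f x) (at x)" "continuous_on UNIV (deriv f)"
proof -
  have d: "(f has_real_derivative frechet_derivative f (at x) 1) (at x)" for x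
  proof -
    have "frechet_derivative f (at x) = (\<lambda>v. frechet_derivative f (at x) 1 * v)"
    proof
      fix v
      have "linear (frechet_derivative f (at x))"
        using C1_frechet(1)[OF assms] has_derivative_linear by blast
      then show "frechet_derivative f (at x) v = frechet_derivative f (at x) 1 * v"
        using linear_scale[of "frechet_derivative f (at x)" v 1] by (simp add: mult.commute)
    qed
    then show ?thesis
      using C1_frechet(1)[OF assms, of x] unfolding has_field_derivative_def by simp
  qed
  then have "deriv f x = frechet_derivative f (at x) 1" for x
    by (rule DERIV_imp_deriv)
  then show "(f has_real_derivative deriv f x) (at x)" "continuous_on UNIV (deriv f)"
    using d C1_frechet(2)[OF assms, of 1] by auto
qed

lemma divergence_eq:
  assumes "(\<phi> has_derivative D) (at x)"
  shows "divergence \<phi> x = (\<Sum>b\<in>Basis. D b \<bullet> b)"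
  using frechet_derivative_at[OF assms] by (simp add: divergence_def)

lemma continuous_on_divergence: "C1 \<phi> \<Longrightarrow> continuous_on S (divergence \<phi>)"
  unfolding divergence_def
  by (intro continuous_intros continuous_on_subset[OF C1_frechet(2) subset_UNIV])

lemma divergence_add:
  assumes "C1 f" "C1 g"
  shows "divergence (\<lambda>x. f x + g x) x = divergence f x + divergence g x"
  using divergence_eq[OF has_derivative_add[OF C1_frechet(1)[OF assms(1)] C1_frechet(1)[OF assms(2)]]]
  by (simp add: divergence_def inner_add_left sum.distrib)

lemma divergence_scaleR:
  assumes "C1 f"
  shows "divergence (\<lambda>x. c *\<^sub>R f x) x = c * divergence f x"
  using divergence_eq[OF has_derivative_scaleR_right[OF C1_frechet(1)[OF assms]]]
  by (simp add: divergence_def sum_distrib_left)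

lemma divergence_const: "divergence (\<lambda>x. c) x = 0"
  using divergence_eq[OF has_derivative_const] by simp

lemma C1_slice_fst: "C1 \<Phi> \<Longrightarrow> C1 (\<lambda>x. \<Phi> (x, t))"
  by (rule C1_compose[where g = "\<lambda>x. (x, t)"]) (auto intro: C1_Pair C1_id C1_const)

lemma C1_slice_snd: "C1 \<Phi> \<Longrightarrow> C1 (\<lambda>t. \<Phi> (x, t))"
  by (rule C1_compose[where g = "\<lambda>t. (x, t)"]) (auto intro: C1_Pair C1_id C1_const)

lemma deriv_snd_component:
  fixes \<Phi> :: "'a::euclidean_space \<times> real \<Rightarrow> 'a \<times> real"
  assumes "C1 \<Phi>"
  shows "deriv (\<lambda>t. snd (\<Phi> (x, t))) t = snd (frechet_derivative \<Phi> (at (x, t)) (0, 1))"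
proof -
  let ?D = "frechet_derivative \<Phi> (at (x, t))"
  have D: "(\<Phi> has_derivative ?D) (at (x, t))"
    by (rule C1_frechet(1)[OF assms])
  have "((\<lambda>t. \<Phi> (x, t)) has_derivative (\<lambda>v. ?D (0, v))) (at t)"
    by (rule has_derivative_compose[where f = "\<lambda>t. (x, t)", OF _ D]) (auto intro!: derivative_eq_intros)
  then have "((\<lambda>t. snd (\<Phi> (x, t))) has_derivative (\<lambda>v. snd (?D (0, v)))) (at t)"
    by (rule has_derivative_snd)
  moreover have "(\<lambda>v. snd (?D (0, v))) = (*) (snd (?D (0, 1)))"
  proof
    fix v
    have "?D (0, v) = v *\<^sub>R ?D (0, 1)"
      using linear_scale[OF has_derivative_linear[OF D], of v "(0, 1)"] by simp
    then show "snd (?D (0, v)) = snd (?D (0, 1)) * v" by simp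
  qed
  ultimately show ?thesis
    by (intro DERIV_imp_deriv) (simp add: has_field_derivative_def)
qed

text \<open>
  Splitting the divergence on a product into its horizontal and vertical parts is the only link
  between perimeters in dimension \<open>N + 1\<close> and in dimension \<open>N\<close>: for fixed \<open>t\<close> the horizontal
  part is the divergence of a field on the fibre.
\<close>

lemma divergence_prod:
  fixes \<Phi> :: "'a::euclidean_space \<times> real \<Rightarrow> 'a \<times> real"
  assumes "C1 \<Phi>"
  shows "divergence \<Phi> (x, t) =
    divergence (\<lambda>x. fst (\<Phi> (x, t))) x + deriv (\<lambda>t. snd (\<Phi> (x, t))) t"
proof -
  let ?D = "frechet_derivative \<Phi> (at (x, t))"
  have D: "(\<Phi> has_derivative ?D) (at (x, t))"
    by (rule C1_frechet(1)[OF assms])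
  have "((\<lambda>x. \<Phi> (x, t)) has_derivative (\<lambda>v. ?D (v, 0))) (at x)"
    by (rule has_derivative_compose[where f = "\<lambda>x. (x, t)", OF _ D]) (auto intro!: derivative_eq_intros)
  then have "divergence (\<lambda>x. fst (\<Phi> (x, t))) x = (\<Sum>b\<in>Basis. fst (?D (b, 0)) \<bullet> b)"
    by (intro divergence_eq has_derivative_fst)
  moreover have "divergence \<Phi> (x, t) = (\<Sum>b\<in>Basis. fst (?D (b, 0)) \<bullet> b) + snd (?D (0, 1))"
    unfolding divergence_def Basis_prod_def
    by (subst sum.union_disjoint)
      (auto simp: sum.reindex inj_on_def inner_prod_def)
  ultimately show ?thesis
    using deriv_snd_component[OF assms] by simp
qed

section \<open>A continuously differentiable Urysohn function\<close>

lemma C1_norm_power2: "C1 (\<lambda>x::'a::euclidean_space. (norm (x - a))\<^sup>2)"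
  unfolding power2_norm_eq_inner
  by (rule C1I[where f' = "\<lambda>x v. 2 * ((x - a) \<bullet> v)"])
    (auto intro!: derivative_eq_intros continuous_intros simp: inner_commute)

lemma C1_max0_power2: "C1 (\<lambda>s::real. (max 0 s)\<^sup>2)"
proof (rule C1_real[where f' = "\<lambda>s. 2 * max 0 s"])
  fix s :: real
  consider "s > 0" | "s < 0" | "s = 0" by linarith
  then show "((\<lambda>s. (max 0 s)\<^sup>2) has_real_derivative 2 * max 0 s) (at s)"
  proof cases
    case 1
    have "((\<lambda>s. s\<^sup>2) has_real_derivative 2 * max 0 s) (at s)"
      using 1 by (auto intro!: derivative_eq_intros)
    then show ?thesis
      by (rule has_field_derivative_transform_within_open[where S = "{0<..}"]) (use 1 in auto)
  next
    case 2
    have "((\<lambda>s. 0) has_real_derivative 2 * max 0 s) (at s)"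
      using 2 by simp
    then show ?thesis
      by (rule has_field_derivative_transform_within_open[where S = "{..<0}"]) (use 2 in auto)
  next
    case 3
    have "((\<lambda>h::real. max 0 h) \<longlongrightarrow> max 0 0) (at 0)"
      by (intro tendsto_intros)
    moreover have "(max 0 h)\<^sup>2 / h = max 0 h" for h :: real
      by (auto simp: max_def power2_eq_square)
    ultimately show ?thesis
      using 3 by (simp add: DERIV_def)
  qed
qed (intro continuous_intros)

text \<open>
  Finitely many bumps of the form \<open>(max 0 (1 - \<bar>x\<bar>\<^sup>2))\<^sup>2\<close>, suitably rescaled so that they are at least
  1 on small balls covering \<open>K\<close> and vanish outside \<open>U\<close>, have a sum \<open>s\<close> that is at least 1 on \<open>K\<close>.
  Composing with \<open>s \<mapsto> 1 - (max 0 (1 - s))\<^sup>2\<close>, which is continuously differentiable and constant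
  from 1 onwards, cuts the sum off at height 1. Squared positive parts are smooth enough here, so
  neither exponential bumps nor mollification are involved.
\<close>

lemma C1_urysohn:
  fixes K U :: "'a::euclidean_space set"
  assumes "compact K" "open U" "K \<subseteq> U"
  obtains \<psi> :: "'a \<Rightarrow> real" where "C1 \<psi>" "\<And>x. 0 \<le> \<psi> x" "\<And>x. \<psi> x \<le> 1"
    "\<And>x. x \<in> K \<Longrightarrow> \<psi> x = 1" "\<And>x. x \<notin> U \<Longrightarrow> \<psi> x = 0"
proof -
  define q where "q s = (max 0 s)\<^sup>2" for s :: real
  have q: "C1 q" unfolding q_def by (rule C1_max0_power2)
  obtain r where r: "\<And>a. a \<in> K \<Longrightarrow> r a > 0" "\<And>a. a \<in> K \<Longrightarrow> ball a (2 * r a) \<subseteq> U"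
  proof -
    have "\<forall>a\<in>K. \<exists>e>0. ball a (2 * e) \<subseteq> U"
    proof
      fix a assume "a \<in> K"
      then obtain e where "e > 0" "ball a e \<subseteq> U"
        using assms open_contains_ball by (metis subsetD)
      then show "\<exists>e>0. ball a (2 * e) \<subseteq> U"
        by (intro exI[of _ "e / 2"]) auto
    qed
    then show ?thesis using that by metis
  qed
  obtain A where A: "A \<subseteq> K" "finite A" "K \<subseteq> (\<Union>a\<in>A. ball a (r a))"
  proof (rule compactE_image[OF assms(1), of K "\<lambda>a. ball a (r a)"])
    show "K \<subseteq> (\<Union>a\<in>K. ball a (r a))" using r(1) by auto
  qed auto
  define b where "b a x = q ((4 * (r a)\<^sup>2 - (norm (x - a))\<^sup>2) / (3 * (r a)\<^sup>2))" for a x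
  define \<psi> where "\<psi> x = 1 - q (1 - (\<Sum>a\<in>A. b a x))" for x
  have b0: "b a x \<ge> 0" for a x
    unfolding b_def q_def by simp
  then have s0: "(\<Sum>a\<in>A. b a x) \<ge> 0" for x
    by (simp add: sum_nonneg)
  have C1b: "C1 (b a)" for a
  proof -
    have "C1 (\<lambda>x. (1 / (3 * (r a)\<^sup>2)) * (4 * (r a)\<^sup>2 - (norm (x - a))\<^sup>2))"
      by (intro C1_mult C1_diff C1_const C1_norm_power2)
    from C1_compose[OF q this] show ?thesis
      unfolding b_def by simp
  qed
  show ?thesis
  proof
    show "C1 \<psi>"
      unfolding \<psi>_def by (intro C1_diff C1_const C1_compose[OF q] C1_sum A C1b)
    show "0 \<le> \<psi> x" for x
    proof -
      have "(max 0 (1 - (\<Sum>a\<in>A. b a x)))\<^sup>2 \<le> 1\<^sup>2"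
        by (rule power_mono) (use s0 in auto)
      then show ?thesis unfolding \<psi>_def q_def by simp
    qed
    show "\<psi> x \<le> 1" for x
      unfolding \<psi>_def q_def by simp
    show "\<psi> x = 1" if "x \<in> K" for x
    proof -
      obtain a where a: "a \<in> A" "x \<in> ball a (r a)" using A(3) \<open>x \<in> K\<close> by blast
      then have "norm (x - a) < r a" by (simp add: dist_norm norm_minus_commute)
      then have "(norm (x - a))\<^sup>2 \<le> (r a)\<^sup>2" by (intro power_mono) auto
      moreover have "r a > 0" using a A r by auto
      ultimately have "(4 * (r a)\<^sup>2 - (norm (x - a))\<^sup>2) / (3 * (r a)\<^sup>2) \<ge> 1"
        by (simp add: field_simps)
      then have "b a x \<ge> 1"
        unfolding b_def q_def by (metis max.coboundedI2 one_le_power)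
      then have "(\<Sum>a\<in>A. b a x) \<ge> 1"
        using member_le_sum[OF a(1), of "\<lambda>a. b a x"] b0 A(2) by force
      then show ?thesis unfolding \<psi>_def q_def by simp
    qed
    show "\<psi> x = 0" if "x \<notin> U" for x
    proof -
      have "b a x = 0" if a: "a \<in> A" for a
      proof -
        have "r a > 0" "x \<notin> ball a (2 * r a)" using a A(1) r \<open>x \<notin> U\<close> by blast+
        then have "norm (x - a) \<ge> 2 * r a" by (simp add: dist_norm norm_minus_commute)
        then have "(norm (x - a))\<^sup>2 \<ge> (2 * r a)\<^sup>2" 
          using \<open>r a > 0\<close> by (intro power_mono) auto
        then have "(4 * (r a)\<^sup>2 - (norm (x - a))\<^sup>2) / (3 * (r a)\<^sup>2) \<le> 0"
          by (intro divide_nonpos_nonneg) (auto simp: power_mult_distrib)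
        then show ?thesis unfolding b_def q_def by simp
      qed
      then show ?thesis unfolding \<psi>_def q_def by simp
    qed
  qed
qed

section \<open>Perimeter and integrals over Borel sets\<close>

lemma set_lint_lebesgue_eq_lborel:
  fixes f :: "'a::euclidean_space \<Rightarrow> real"
  assumes "E \<in> sets borel" "f \<in> borel_measurable borel"
  shows "(LINT x:E|lebesgue. f x) = (LINT x|lborel. indicator E x * f x)"
proof -
  have "(\<lambda>x. indicator E x *\<^sub>R f x) \<in> borel_measurable lborel"
    using assms by measurable
  then show ?thesis
    unfolding set_lebesgue_integral_def by (subst integral_completion) auto
qed

lemma integrable_indicator_continuous:
  fixes f :: "'a::euclidean_space \<Rightarrow> real"
  assumes E: "E \<in> sets borel" "bounded E" and f: "continuous_on UNIV f"
  shows "integrable lborel (\<lambda>x. indicator E x * f x)"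
proof -
  obtain R where R: "E \<subseteq> ball 0 R"
    using E(2) bounded_subset_ballD by blast
  have "integrable lborel (\<lambda>x. indicator (cball 0 R) x *\<^sub>R f x)"
    by (intro borel_integrable_compact continuous_on_subset[OF f]) auto
  then show ?thesis
  proof (rule Bochner_Integration.integrable_bound)
    have "f \<in> borel_measurable borel"
      using f by (rule borel_measurable_continuous_onI)
    then show "(\<lambda>x. indicator E x * f x) \<in> borel_measurable lborel"
      using E(1) by measurable
  qed (use R in \<open>auto simp: indicator_def subset_eq less_imp_le\<close>)
qed

lemma measure_lebesgue_borel: "E \<in> sets borel \<Longrightarrow> measure lebesgue E = measure lborel E"
  by (simp add: measure_completion)

lemma divergence_cong_open:
  assumes "C1 f" "open S" "x \<in> S" "\<And>y. y \<in> S \<Longrightarrow> f y = g y"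
  shows "divergence g x = divergence f x"
proof -
  have "(g has_derivative frechet_derivative f (at x)) (at x)"
    by (rule has_derivative_transform_within_open[OF C1_frechet(1)[OF assms(1)] assms(2,3,4)])
  from divergence_eq[OF this] show ?thesis
    by (simp add: divergence_def)
qed

text \<open>
  On a bounded set the support of a test field is irrelevant: a cut-off equal to 1 near the set
  changes neither the divergence on the set nor the bound on the norm. All fields constructed
  below therefore need not have compact support.
\<close>

lemma perimeter_ge_C1:
  fixes E :: "'a::euclidean_space set"
  assumes E: "bounded E" "E \<in> sets lebesgue" and \<Phi>: "C1 \<Phi>" "\<And>x. norm (\<Phi> x) \<le> 1"
  shows "ereal (LINT x:E|lebesgue. divergence \<Phi> x) \<le> perimeter E"
proof -
  obtain R where R: "R > 0" "E \<subseteq> ball 0 R"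
    using E(1) bounded_subset_ballD by blast
  obtain \<kappa> :: "'a \<Rightarrow> real" where \<kappa>: "C1 \<kappa>" "\<And>x. 0 \<le> \<kappa> x" "\<And>x. \<kappa> x \<le> 1"
    "\<And>x. x \<in> cball 0 R \<Longrightarrow> \<kappa> x = 1" "\<And>x. x \<notin> ball 0 (R + 1) \<Longrightarrow> \<kappa> x = 0"
  proof (rule C1_urysohn[of "cball 0 R" "ball (0::'a) (R + 1)"])
    show "cball 0 R \<subseteq> ball (0::'a) (R + 1)" by auto
  qed auto
  have "C1 (\<lambda>x. \<kappa> x *\<^sub>R \<Phi> x)"
    by (rule C1_scaleR[OF \<kappa>(1) \<Phi>(1)])
  moreover have "bounded {x. \<kappa> x *\<^sub>R \<Phi> x \<noteq> 0}"
  proof (rule bounded_subset[OF bounded_ball])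
    show "{x. \<kappa> x *\<^sub>R \<Phi> x \<noteq> 0} \<subseteq> ball 0 (R + 1)"
      using \<kappa>(5) by force
  qed
  ultimately have "C1_compact_support (\<lambda>x. \<kappa> x *\<^sub>R \<Phi> x)"
    by (simp add: C1_compact_support_iff)
  moreover have "norm (\<kappa> x *\<^sub>R \<Phi> x) \<le> 1" for x
    using mult_mono[OF \<kappa>(3) \<Phi>(2), of x x] \<kappa>(2)[of x] by simp
  ultimately have "ereal (LINT x:E|lebesgue. divergence (\<lambda>x. \<kappa> x *\<^sub>R \<Phi> x) x) \<le> perimeter E"
    unfolding perimeter_def by (intro SUP_upper) auto
  moreover have "divergence (\<lambda>x. \<kappa> x *\<^sub>R \<Phi> x) x = divergence \<Phi> x" if "x \<in> E" for x
    by (rule divergence_cong_open[OF \<Phi>(1), of "ball 0 R"]) (use R that \<kappa>(4) in auto)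
  then have "(LINT x:E|lebesgue. divergence (\<lambda>x. \<kappa> x *\<^sub>R \<Phi> x) x) = (LINT x:E|lebesgue. divergence \<Phi> x)"
    by (intro set_lebesgue_integral_cong) (use E(2) in auto)
  ultimately show ?thesis by simp
qed

lemma perimeter_nonneg: "0 \<le> perimeter (E::'a::euclidean_space set)"
proof -
  have "C1_compact_support (\<lambda>x::'a. 0::'a)"
    by (simp add: C1_compact_support_iff C1_const)
  then have "ereal (LINT x:E|lebesgue. divergence (\<lambda>x. 0) x) \<le> perimeter E"
    unfolding perimeter_def by (intro SUP_upper) auto
  then show ?thesis by (simp add: divergence_const zero_ereal_def)
qed

lemma perimeter_scaled_field:
  fixes E :: "'a::euclidean_space set"
  assumes E: "bounded E" "E \<in> sets borel" and p: "perimeter E \<le> ereal p" and "r > 0"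
    and \<Phi>: "C1 \<Phi>" "\<And>x. norm (\<Phi> x) \<le> r"
  shows "(LINT x|lborel. indicator E x * divergence \<Phi> x) \<le> r * p"
proof -
  have "C1 (\<lambda>x. (1 / r) *\<^sub>R \<Phi> x)"
    by (intro C1_scaleR C1_const \<Phi>)
  then have "ereal (LINT x:E|lebesgue. divergence (\<lambda>x. (1 / r) *\<^sub>R \<Phi> x) x) \<le> perimeter E"
    by (rule perimeter_ge_C1[rotated 2]) (use E \<Phi>(2) \<open>r > 0\<close> in auto)
  with p have "(LINT x:E|lebesgue. divergence (\<lambda>x. (1 / r) *\<^sub>R \<Phi> x) x) \<le> p"
    by (meson ereal_less_eq(3) order_trans)
  also have "(LINT x:E|lebesgue. divergence (\<lambda>x. (1 / r) *\<^sub>R \<Phi> x) x) = 1 / r * (LINT x:E|lebesgue. divergence \<Phi> x)"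
    unfolding divergence_scaleR[OF \<Phi>(1)] by (rule set_integral_mult_right)
  also have "(LINT x:E|lebesgue. divergence \<Phi> x) = (LINT x|lborel. indicator E x * divergence \<Phi> x)"
    by (intro set_lint_lebesgue_eq_lborel E borel_measurable_continuous_onI continuous_on_divergence \<Phi>)
  finally show ?thesis
    using \<open>r > 0\<close> by (simp add: field_simps)
qed

text \<open>
  Perimeter and measure ignore null sets, so competitors may be taken Borel. This matters for
  slicing: every fibre of a Borel set is Borel, whereas fibres of a Lebesgue set need not be
  measurable.
\<close>

lemma borel_kernel:
  fixes E :: "'a::euclidean_space set"
  assumes "E \<in> sets lebesgue"
  obtains E0 where "E0 \<in> sets borel" "E0 \<subseteq> E" "measure lebesgue E = measure lborel E0"
    "perimeter E = perimeter E0"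
proof -
  obtain C T where CT: "fsigma C" "T \<in> null_sets lebesgue" "C \<union> T = E" "disjnt C T"
    by (rule lebesgue_set_almost_fsigma[OF assms])
  have C: "C \<in> sets borel"
    using CT(1) by (auto elim!: fsigma.cases)
  have "measure lebesgue E = measure lebesgue C"
    using measure_Un_null_set[of C lebesgue T] C CT by simp
  then have 1: "measure lebesgue E = measure lborel C"
    using measure_lebesgue_borel[OF C] by simp
  have "(LINT x:E|lebesgue. divergence \<phi> x) = (LINT x:C|lebesgue. divergence \<phi> x)"
    if "C1_compact_support \<phi>" for \<phi>
  proof -
    have "C1 \<phi>" using that by (simp add: C1_compact_support_iff)
    then have "divergence \<phi> \<in> borel_measurable lborel"
      using borel_measurable_continuous_onI[OF continuous_on_divergence] by simp
    then have m: "divergence \<phi> \<in> borel_measurable lebesgue"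
      by (rule measurable_completion)
    have "AE x in lebesgue. x \<notin> T"
      using CT(2) by (rule AE_not_in)
    then have "AE x in lebesgue. indicator E x *\<^sub>R divergence \<phi> x = indicator C x *\<^sub>R divergence \<phi> x"
      by eventually_elim (use CT(3) in \<open>auto simp: indicator_def\<close>)
    then show ?thesis
      unfolding set_lebesgue_integral_def
    proof (rule integral_cong_AE[rotated 2])
      have "C \<in> sets lebesgue" using C by simp
      with m assms show "(\<lambda>x. indicator E x *\<^sub>R divergence \<phi> x) \<in> borel_measurable lebesgue"
        "(\<lambda>x. indicator C x *\<^sub>R divergence \<phi> x) \<in> borel_measurable lebesgue"
        by (blast intro: borel_measurable_scaleR borel_measurable_indicator)+
    qed
  qed
  then have "perimeter E = perimeter C"
    unfolding perimeter_def by (intro SUP_cong) auto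
  then show ?thesis
    using that[OF C] 1 CT by auto
qed

section \<open>Sets of small measure have large perimeter\<close>

lemma C1_approx_indicator:
  fixes E :: "'a::euclidean_space set"
  assumes E: "bounded E" "E \<in> sets borel" and "e > 0"
  obtains \<psi> :: "'a \<Rightarrow> real" and R where "C1 \<psi>" "\<And>x. 0 \<le> \<psi> x" "\<And>x. \<psi> x \<le> 1"
    "R \<in> sets borel" "emeasure lborel R < ennreal e" "\<And>x. x \<notin> R \<Longrightarrow> \<psi> x = indicator E x"
proof -
  have EL: "E \<in> sets lebesgue" using E by simp
  obtain U where U: "open U" "E \<subseteq> U" "U - E \<in> lmeasurable" "emeasure lebesgue (U - E) < ennreal (e / 2)"
    using sets_lebesgue_outer_open[OF EL, of "e / 2"] \<open>e > 0\<close> by auto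
  obtain K where K: "closed K" "K \<subseteq> E" "E - K \<in> lmeasurable" "emeasure lebesgue (E - K) < ennreal (e / 2)"
    using sets_lebesgue_inner_closed[OF EL, of "e / 2"] \<open>e > 0\<close> by auto
  have "compact K"
    using K E(1) bounded_subset compact_eq_bounded_closed by blast
  then obtain \<psi> :: "'a \<Rightarrow> real" where \<psi>: "C1 \<psi>" "\<And>x. 0 \<le> \<psi> x" "\<And>x. \<psi> x \<le> 1"
    "\<And>x. x \<in> K \<Longrightarrow> \<psi> x = 1" "\<And>x. x \<notin> U \<Longrightarrow> \<psi> x = 0"
    using C1_urysohn[of K U] U K by (metis subset_trans)
  have "emeasure lborel (U - K) = emeasure lebesgue ((U - E) \<union> (E - K))"
  proof -
    have "U - K = (U - E) \<union> (E - K)" using U K by auto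
    moreover have "U - K \<in> sets lborel" using U(1) K(1) by simp
    then have "emeasure lborel (U - K) = emeasure lebesgue (U - K)"
      by (simp only: emeasure_completion main_part sets_completionI_sets)
    ultimately show ?thesis by simp
  qed
  also have "\<dots> \<le> emeasure lebesgue (U - E) + emeasure lebesgue (E - K)"
    by (rule emeasure_subadditive) (use U K in auto)
  also have "\<dots> < ennreal (e / 2) + ennreal (e / 2)"
    using U(4) K(4) by (rule add_strict_mono)
  also have "\<dots> = ennreal e"
    using \<open>e > 0\<close> by (simp flip: ennreal_plus)
  finally have "emeasure lborel (U - K) < ennreal e" .
  moreover have "\<psi> x = indicator E x" if "x \<notin> U - K" for x
    using that \<psi>(4,5)[of x] U(2) K(2) by (auto simp: indicator_def)
  ultimately show ?thesis
    using that[OF \<psi>(1-3), of "U - K"] U(1) K(1) by simp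
qed

text \<open>
  The field is \<open>- G v\<close>, where \<open>G x\<close> is the average of \<open>\<psi>\<close> over the segment from \<open>x\<close> to \<open>x + v\<close>; its
  divergence is minus the derivative of \<open>G\<close> along \<open>v\<close>, which telescopes. With \<open>\<psi>\<close> close to the
  indicator of a set \<open>E\<close>, it tests how much of \<open>E\<close> a translation moves out of \<open>E\<close>.
\<close>

lemma translation_field:
  fixes \<psi> :: "'a::euclidean_space \<Rightarrow> real"
  assumes \<psi>: "C1 \<psi>" "\<And>x. 0 \<le> \<psi> x" "\<And>x. \<psi> x \<le> 1"
  obtains \<Phi> :: "'a \<Rightarrow> 'a" where "C1 \<Phi>" "\<And>x. norm (\<Phi> x) \<le> norm v"
    "\<And>x. divergence \<Phi> x = \<psi> x - \<psi> (x + v)"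
proof -
  let ?D = "\<lambda>x. frechet_derivative \<psi> (at x)"
  have D: "(\<psi> has_derivative ?D x) (at x)" for x
    by (rule C1_frechet[OF \<psi>(1)])
  have bl: "bounded_linear (?D x)" for x
    using D has_derivative_bounded_linear by blast
  define B where "B x = Blinfun (?D x)" for x
  have B: "blinfun_apply (B x) = ?D x" for x
    unfolding B_def by (rule bounded_linear_Blinfun_apply[OF bl])
  have Bc: "continuous_on UNIV B"
    by (rule continuous_on_blinfun_componentwise) (simp add: B C1_frechet(2)[OF \<psi>(1)])
  define G where "G x = integral (cbox 0 1) (\<lambda>s::real. \<psi> (x + s *\<^sub>R v))" for x
  define G' where "G' x = integral (cbox 0 1) (\<lambda>s::real. B (x + s *\<^sub>R v))" for x
  have cont: "continuous_on S (\<lambda>s::real. \<psi> (x + s *\<^sub>R v))" for S x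
    by (rule continuous_on_compose2[OF C1_continuous[OF \<psi>(1), of UNIV]]) (auto intro!: continuous_intros)
  have contB: "continuous_on S (\<lambda>s::real. B (x + s *\<^sub>R v))" for S x
    by (rule continuous_on_compose2[OF Bc]) (auto intro!: continuous_intros)
  have contB2: "continuous_on S (\<lambda>(x, s::real). B (x + s *\<^sub>R v))" for S
    unfolding case_prod_unfold
    by (rule continuous_on_compose2[OF Bc]) (auto intro!: continuous_intros)
  have dG: "(G has_derivative G' x) (at x)" for x
    unfolding G_def G'_def
  proof (rule leibniz_rule)
    fix x :: 'a and s :: real
    show "((\<lambda>x. \<psi> (x + s *\<^sub>R v)) has_derivative blinfun_apply (B (x + s *\<^sub>R v))) (at x within UNIV)"
      unfolding B by (rule has_derivative_compose[where f = "\<lambda>x. x + s *\<^sub>R v", OF _ D])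
        (auto intro!: derivative_eq_intros)
    show "(\<lambda>s. \<psi> (x + s *\<^sub>R v)) integrable_on cbox 0 1"
      by (intro integrable_continuous cont)
  qed (use contB2 in auto)
  have G'c: "continuous_on UNIV G'"
    unfolding G'_def by (rule integral_continuous_on_param[OF contB2])
  have C1G: "C1 G"
    by (rule C1I[OF dG]) (intro continuous_intros G'c)
  have G0: "0 \<le> G x" for x
    unfolding G_def by (intro integral_nonneg integrable_continuous cont \<psi>)
  have G1: "G x \<le> 1" for x
  proof -
    have "G x \<le> integral (cbox 0 (1::real)) (\<lambda>s. 1)"
      unfolding G_def by (intro integral_le integrable_continuous cont \<psi>) auto
    then show ?thesis by simp
  qed
  have G'v: "G' x v = \<psi> (x + v) - \<psi> x" for x
  proof -
    have "G' x v = integral (cbox 0 (1::real)) (\<lambda>s. B (x + s *\<^sub>R v) v)"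
      unfolding G'_def
      by (rule blinfun_apply_integral) (intro integrable_continuous contB)
    moreover have "((\<lambda>s. B (x + s *\<^sub>R v) v) has_integral (\<psi> (x + 1 *\<^sub>R v) - \<psi> (x + 0 *\<^sub>R v))) {0..1::real}"
    proof (rule fundamental_theorem_of_calculus)
      fix s :: real
      have "((\<lambda>s. \<psi> (x + s *\<^sub>R v)) has_derivative (\<lambda>h. ?D (x + s *\<^sub>R v) (h *\<^sub>R v))) (at s)"
        by (rule has_derivative_compose[where f = "\<lambda>s. x + s *\<^sub>R v", OF _ D])
          (auto intro!: derivative_eq_intros)
      moreover have "?D (x + s *\<^sub>R v) (h *\<^sub>R v) = h *\<^sub>R ?D (x + s *\<^sub>R v) v" for h
        by (rule linear_scale) (rule bounded_linear.linear[OF bl])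
      ultimately show "((\<lambda>s. \<psi> (x + s *\<^sub>R v)) has_vector_derivative B (x + s *\<^sub>R v) v) (at s within {0..1})"
        unfolding has_vector_derivative_def B by (simp add: has_derivative_at_withinI)
    qed auto
    ultimately show ?thesis
      by (simp add: integral_unique cbox_interval)
  qed
  show ?thesis
  proof
    show "C1 (\<lambda>x. (- G x) *\<^sub>R v)"
      using C1_scaleR[OF C1_diff[OF C1_const[of 0] C1G] C1_const[of v]] by simp
    show "norm ((- G x) *\<^sub>R v) \<le> norm v" for x
      using G0[of x] G1[of x] by (simp add: mult_left_le_one_le)
    show "divergence (\<lambda>x. (- G x) *\<^sub>R v) x = \<psi> x - \<psi> (x + v)" for x
    proof -
      have "((\<lambda>x. (- G x) *\<^sub>R v) has_derivative (\<lambda>h. (- G' x h) *\<^sub>R v)) (at x)"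
        by (auto intro!: derivative_eq_intros dG)
      then have "divergence (\<lambda>x. (- G x) *\<^sub>R v) x = (\<Sum>b\<in>Basis. - G' x b * (v \<bullet> b))"
        using divergence_eq by fastforce
      also have "\<dots> = - (\<Sum>b\<in>Basis. G' x ((v \<bullet> b) *\<^sub>R b))"
        by (simp add: blinfun.scaleR_right sum_negf mult.commute)
      also have "\<dots> = - G' x v"
        by (simp add: euclidean_representation flip: blinfun.sum_right)
      finally show ?thesis using G'v by simp
    qed
  qed
qed

lemma emeasure_translate:
  fixes R :: "'a::euclidean_space set"
  assumes "R \<in> sets borel"
  shows "{x. x + v \<in> R} \<in> sets borel" "emeasure lborel {x. x + v \<in> R} = emeasure lborel R"
proof -
  have "(\<lambda>x. x + v) \<in> borel_measurable borel" by simp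
  from measurable_sets[OF this assms] show 1: "{x. x + v \<in> R} \<in> sets borel"
    by (simp add: vimage_def)
  have "emeasure lborel R = emeasure (distr lborel borel ((+) v)) R"
    by (simp add: lborel_distr_plus)
  also have "\<dots> = emeasure lborel {x. x + v \<in> R}"
    using assms by (subst emeasure_distr) (auto simp: vimage_def add.commute)
  finally show "emeasure lborel {x. x + v \<in> R} = emeasure lborel R" by simp
qed

lemma translation_perimeter:
  fixes E :: "'a::euclidean_space set"
  assumes E: "bounded E" "E \<in> sets borel" and p: "perimeter E \<le> ereal p"
    and r: "r > 0" "norm v \<le> r"
  shows "measure lborel E - measure lborel {x\<in>E. x + v \<in> E} \<le> r * p"
proof (rule field_le_epsilon)
  fix e :: real assume "e > 0"
  obtain \<psi> :: "'a \<Rightarrow> real" and R where \<psi>: "C1 \<psi>" "\<And>x. 0 \<le> \<psi> x" "\<And>x. \<psi> x \<le> 1"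
    and R: "R \<in> sets borel" "emeasure lborel R < ennreal (e / 2)" "\<And>x. x \<notin> R \<Longrightarrow> \<psi> x = indicator E x"
    using C1_approx_indicator[OF E, of "e / 2"] \<open>e > 0\<close> by auto
  obtain \<Phi> where \<Phi>: "C1 \<Phi>" "\<And>x. norm (\<Phi> x) \<le> norm v"
    "\<And>x. divergence \<Phi> x = \<psi> x - \<psi> (x + v)"
    using translation_field[OF \<psi>] by blast
  define A where "A = {x. x + v \<in> E}"
  define T where "T = {x. x + v \<in> R}"
  have A[measurable]: "A \<in> sets borel" and T[measurable]: "T \<in> sets borel" and [measurable]: "E \<in> sets borel"
    and [measurable]: "R \<in> sets borel"
    unfolding A_def T_def using emeasure_translate(1) E(2) R(1) by auto
  have Rf: "emeasure lborel R < \<infinity>"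
    using R(2) by (rule less_trans) simp
  have Tf: "emeasure lborel T = emeasure lborel R"
    unfolding T_def by (rule emeasure_translate(2)[OF R(1)])
  have mR: "measure lborel R \<le> e / 2" "measure lborel T \<le> e / 2"
    unfolding measure_def Tf using R(2) \<open>e > 0\<close> by (intro enn2real_leI; simp)+
  have Ef: "emeasure lborel E < \<infinity>" by (rule emeasure_bounded_finite[OF E(1)])
  have EAf: "emeasure lborel (E \<inter> A) < \<infinity>"
    using emeasure_mono[of "E \<inter> A" E lborel] E(2) Ef by (simp add: order.strict_trans1)
  have "measure lborel E - measure lborel (E \<inter> A) - measure lborel R - measure lborel T
    = (LINT x|lborel. indicator E x - indicator (E \<inter> A) x - indicator R x - indicator T x)"
    using Ef EAf Rf Tf by simp
  also have "\<dots> \<le> (LINT x|lborel. indicator E x * divergence \<Phi> x)"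
  proof (rule integral_mono)
    show "integrable lborel (\<lambda>x. indicator E x - indicator (E \<inter> A) x - indicator R x - indicator T x :: real)"
      using Ef EAf Rf Tf by simp
    show "integrable lborel (\<lambda>x. indicator E x * divergence \<Phi> x)"
      by (intro integrable_indicator_continuous E continuous_on_divergence \<Phi>)
    fix x
    show "indicator E x - indicator (E \<inter> A) x - indicator R x - indicator T x
      \<le> indicator E x * divergence \<Phi> x"
      using R(3)[of x] R(3)[of "x + v"] \<psi>(2,3)[of x] \<psi>(2,3)[of "x + v"] \<Phi>(3)[of x]
      by (auto simp: indicator_def A_def T_def split: if_splits)
  qed
  also have "\<dots> \<le> r * p"
    by (rule perimeter_scaled_field[OF E p r(1) \<Phi>(1)]) (use \<Phi>(2) r(2) order_trans in blast)
  finally show "measure lborel E - measure lborel {x\<in>E. x + v \<in> E} \<le> r * p + e"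
    using mR by (simp add: A_def Int_def)
qed

text \<open>
  A weak isoperimetric inequality. A translation by \<open>v\<close> with \<open>\<bar>v\<bar> \<le> r\<close> moves at most \<open>r P(E)\<close> of the
  mass of \<open>E\<close> out of \<open>E\<close>. On the other hand, by Fubini, the integral over \<open>v\<close> of \<open>\<bar>E \<inter> (E - v)\<bar>\<close> is
  \<open>\<bar>E\<bar>\<^sup>2\<close>, so when \<open>\<bar>E\<bar>\<close> is at most half the volume of the ball of radius \<open>r\<close>, some \<open>v\<close> in that ball
  moves at least half of \<open>E\<close> out. Hence \<open>P(E) \<ge> \<bar>E\<bar> / (2 r)\<close>, and \<open>r\<close> may be as small as desired.
\<close>

lemma small_sets_large_perimeter:
  fixes K :: real
  assumes "K > 0"
  obtains \<delta> where "\<delta> > 0" "\<And>E::'a::euclidean_space set. bounded E \<Longrightarrow> E \<in> sets borel \<Longrightarrow>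
    measure lborel E \<le> \<delta> \<Longrightarrow> ereal (K * measure lborel E) \<le> perimeter E"
proof -
  define r where "r = 1 / (2 * K)"
  have r: "r > 0" using assms by (simp add: r_def)
  define B where "B = (cball 0 r :: 'a set)"
  have [measurable]: "B \<in> sets borel" unfolding B_def by simp
  define b where "b = measure lborel B"
  have b: "b > 0" unfolding b_def B_def using content_cball_pos[OF r] by simp
  have Bb: "emeasure lborel B = ennreal b"
    unfolding b_def B_def using emeasure_bounded_finite[OF bounded_cball, of "0::'a" r]
    by (intro emeasure_eq_ennreal_measure) auto
  show ?thesis
  proof (rule that[of "b / 2"])
    fix E :: "'a set"
    assume E: "bounded E" "E \<in> sets borel" "measure lborel E \<le> b / 2"
    note [measurable] = E(2)
    define m where "m = measure lborel E"
    have Em: "emeasure lborel E = ennreal m"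
      unfolding m_def by (intro emeasure_eq_ennreal_measure) (use emeasure_bounded_finite[OF E(1)] in auto)
    have m0: "m \<ge> 0" unfolding m_def by simp
    show "ereal (K * measure lborel E) \<le> perimeter E"
    proof (rule ccontr)
      assume "\<not> ereal (K * measure lborel E) \<le> perimeter E"
      then obtain p where p: "perimeter E \<le> ereal p" "p < K * m"
        unfolding m_def not_le using less_ereal.simps(1) ereal_dense2 less_imp_le by metis
      have "r * p < m / 2"
        using p(2) assms by (simp add: r_def field_simps)
      then have c: "m / 2 < m - r * p" by simp
      define f where "f v = emeasure lborel {x\<in>E. x + v \<in> E}" for v
      have f: "f v = (\<integral>\<^sup>+x. indicator E x * indicator E (x + v) \<partial>lborel)" for v
      proof -
        have "{x\<in>E. x + v \<in> E} \<in> sets borel"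
          using sets.Int[OF E(2) emeasure_translate(1)[OF E(2), of v]] by (simp add: Int_def)
        then have "f v = (\<integral>\<^sup>+x. indicator {x\<in>E. x + v \<in> E} x \<partial>lborel)"
          unfolding f_def by simp
        also have "\<dots> = (\<integral>\<^sup>+x. indicator E x * indicator E (x + v) \<partial>lborel)"
          by (intro nn_integral_cong) (simp add: indicator_def)
        finally show ?thesis .
      qed
      have "ennreal (m - r * p) * ennreal b = (\<integral>\<^sup>+v. ennreal (m - r * p) * indicator B v \<partial>lborel)"
        by (subst nn_integral_cmult_indicator) (auto simp: Bb)
      also have "\<dots> \<le> (\<integral>\<^sup>+v. f v \<partial>lborel)"
      proof (rule nn_integral_mono)
        fix v :: 'a
        show "ennreal (m - r * p) * indicator B v \<le> f v"
        proof (cases "v \<in> B")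
          case True
          then have "norm v \<le> r" by (simp add: B_def)
          have "m - r * p \<le> measure lborel {x\<in>E. x + v \<in> E}"
            using translation_perimeter[OF E(1,2) p(1) r \<open>norm v \<le> r\<close>] by (simp add: m_def)
          moreover have "emeasure lborel {x\<in>E. x + v \<in> E} < \<infinity>"
            by (rule emeasure_bounded_finite) (rule bounded_subset[OF E(1)], auto)
          ultimately show ?thesis
            using True by (simp add: f_def emeasure_eq_ennreal_measure ennreal_leI)
        qed simp
      qed
      also have "\<dots> = (\<integral>\<^sup>+v. (\<integral>\<^sup>+x. indicator E x * indicator E (x + v) \<partial>lborel) \<partial>lborel)"
        by (simp add: f)
      also have "\<dots> = (\<integral>\<^sup>+x. (\<integral>\<^sup>+v. indicator E x * indicator E (x + v) \<partial>lborel) \<partial>lborel)"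
        by (rule lborel_pair.Fubini') (unfold case_prod_unfold, measurable)
      also have "\<dots> = (\<integral>\<^sup>+x. indicator E x * emeasure lborel E \<partial>lborel)"
      proof (intro nn_integral_cong)
        fix x
        have "(\<integral>\<^sup>+v. indicator E (x + v) \<partial>lborel) = (\<integral>\<^sup>+v. indicator {v. v + x \<in> E} v \<partial>lborel)"
          by (intro nn_integral_cong) (simp add: indicator_def add.commute)
        also have "\<dots> = emeasure lborel E"
          using emeasure_translate[OF E(2), of x] by simp
        finally show "(\<integral>\<^sup>+v. indicator E x * indicator E (x + v) \<partial>lborel) = indicator E x * emeasure lborel E"
          by (simp add: nn_integral_cmult)
      qed
      also have "\<dots> = ennreal m * ennreal m"
        by (simp add: nn_integral_multc Em)
      finally have "(m - r * p) * b \<le> m * m"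
        using c m0 b by (simp flip: ennreal_mult)
      moreover have "m / 2 * b < (m - r * p) * b"
        using c b by simp
      moreover have "m * m \<le> m * (b / 2)"
        using E(3) m0 by (intro mult_left_mono) (auto simp: m_def)
      ultimately show False by (simp add: field_simps)
    qed
  qed (use b in simp)
qed

section \<open>Countably many test fields and their selection along the axis\<close>

text \<open>
  Every subset of the space of continuous functions on a compact set is separable in the uniform
  norm. Functions with oscillation at most \<open>1 / Suc k\<close> at scale \<open>1 / Suc n\<close> are determined up to
  \<open>3 / Suc k\<close> by their values on a finite net, rounded to multiples of \<open>1 / Suc k\<close>; there are only
  countably many such signatures, and \<open>Q\<close> takes one element for each signature that occurs.
\<close>

lemma countable_uniformly_dense:
  fixes F :: "'p \<Rightarrow> 'a::metric_space \<Rightarrow> real"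
  assumes B: "compact B" and cont: "\<And>p. p \<in> P \<Longrightarrow> continuous_on B (F p)"
  obtains Q where "Q \<subseteq> P" "countable Q"
    "\<And>p e. p \<in> P \<Longrightarrow> e > 0 \<Longrightarrow> \<exists>q\<in>Q. \<forall>x\<in>B. \<bar>F p x - F q x\<bar> < e"
proof -
  have "\<exists>G. finite G \<and> G \<subseteq> B \<and> B \<subseteq> (\<Union>a\<in>G. ball a (1 / Suc n))" for n
  proof -
    have "B \<subseteq> (\<Union>a\<in>B. ball a (1 / Suc n))" by auto
    then show ?thesis
      using compactE_image[OF B, of B "\<lambda>a. ball a (1 / Suc n)"] by (metis open_ball)
  qed
  then obtain G where G: "\<And>n. finite (G n)" "\<And>n. G n \<subseteq> B" "\<And>n. B \<subseteq> (\<Union>a\<in>G n. ball a (1 / Suc n))"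
    by metis
  \<comment> \<open>\<open>\<sigma> n k p\<close> is the rounded signature on the net \<open>G n\<close>, informative for \<open>p\<close> in \<open>S n k\<close>.\<close>
  define S where "S n k = {p\<in>P. \<forall>x\<in>B. \<forall>y\<in>B. dist x y < 1 / Suc n \<longrightarrow> \<bar>F p x - F p y\<bar> \<le> 1 / Suc k}" for n k
  define \<sigma> where "\<sigma> n k p = restrict (\<lambda>a. \<lfloor>F p a * Suc k\<rfloor>) (G n)" for n k p
  have "\<exists>Y. countable Y \<and> Y \<subseteq> S n k \<and> \<sigma> n k ` S n k = \<sigma> n k ` Y" for n k
  proof -
    have "\<sigma> n k ` S n k \<subseteq> G n \<rightarrow>\<^sub>E UNIV" unfolding \<sigma>_def by auto
    moreover have "countable (G n \<rightarrow>\<^sub>E (UNIV :: int set))"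
      by (intro countable_PiE G) auto
    ultimately have "countable (\<sigma> n k ` S n k)" by (rule countable_subset)
    then show ?thesis using countable_subset_image[of "\<sigma> n k ` S n k" "\<sigma> n k" "S n k"] by auto
  qed
  then obtain Y where Y: "\<And>n k. countable (Y n k)" "\<And>n k. Y n k \<subseteq> S n k"
    "\<And>n k. \<sigma> n k ` S n k = \<sigma> n k ` Y n k"
    by metis
  show ?thesis
  proof
    show "(\<Union>n k. Y n k) \<subseteq> P" using Y(2) unfolding S_def by blast
    show "countable (\<Union>n k. Y n k)" using Y(1) by blast
    fix p and e :: real assume p: "p \<in> P" and "e > 0"
    obtain k :: nat where k: "1 / Suc k < e / 3"
      using nat_approx_posE[of "e / 3"] \<open>e > 0\<close> by auto
    have "uniformly_continuous_on B (F p)"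
      by (rule compact_uniformly_continuous[OF cont[OF p] B])
    then obtain d where d: "d > 0" "\<And>x y. x \<in> B \<Longrightarrow> y \<in> B \<Longrightarrow> dist y x < d \<Longrightarrow> dist (F p y) (F p x) < 1 / Suc k"
      unfolding uniformly_continuous_on_def by (metis of_nat_0_less_iff zero_less_Suc zero_less_divide_1_iff)
    obtain n :: nat where n: "1 / Suc n < d"
      using nat_approx_posE[OF d(1)] by auto
    have "p \<in> S n k"
      unfolding S_def using p d(2) n by (force simp: dist_real_def)
    then obtain q where q: "q \<in> Y n k" "\<sigma> n k p = \<sigma> n k q"
      using Y(3)[of n k] by (metis imageE imageI)
    have "\<bar>F p x - F q x\<bar> < e" if x: "x \<in> B" for x
    proof -
      obtain a where a: "a \<in> G n" "dist x a < 1 / Suc n"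
        using G(3)[of n] x by (auto simp: dist_commute)
      then have "a \<in> B" using G(2) by auto
      have "\<bar>F p x - F p a\<bar> \<le> 1 / Suc k" "\<bar>F q x - F q a\<bar> \<le> 1 / Suc k"
        using \<open>p \<in> S n k\<close> q(1) Y(2) x a \<open>a \<in> B\<close> unfolding S_def by blast+
      moreover have "\<lfloor>F p a * Suc k\<rfloor> = \<lfloor>F q a * Suc k\<rfloor>"
        using fun_cong[OF q(2), of a] a(1) by (simp add: \<sigma>_def)
      then have "\<bar>F p a * Suc k - F q a * Suc k\<bar> < 1"
        by linarith
      then have "\<bar>F p a - F q a\<bar> * Suc k < 1"
        by (simp add: abs_mult flip: left_diff_distrib)
      then have "\<bar>F p a - F q a\<bar> < 1 / Suc k"
        by (simp add: field_simps)
      ultimately show ?thesis using k by linarith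
    qed
    then show "\<exists>q\<in>(\<Union>n k. Y n k). \<forall>x\<in>B. \<bar>F p x - F q x\<bar> < e"
      using q(1) by blast
  qed
qed

text \<open>
  Only the divergence of a test field enters the perimeter of subsets of \<open>A\<close>, and only through its
  values on \<open>A\<close>; so separability of the set of these divergences yields one sequence of fields that
  computes the perimeter of all Borel subsets of \<open>A\<close> at once. Countability is what allows a nearly
  optimal field to be chosen measurably in \<open>t\<close> for the fibres of a set in the cylinder.
\<close>

lemma countable_test_fields:
  fixes A :: "'a::euclidean_space set"
  assumes A: "bounded A"
  obtains \<phi> :: "nat \<Rightarrow> 'a \<Rightarrow> 'a" where "\<And>j. C1 (\<phi> j)" "\<And>j x. norm (\<phi> j x) \<le> 1"
    "\<And>E r. E \<subseteq> A \<Longrightarrow> E \<in> sets borel \<Longrightarrow> ereal r < perimeter E \<Longrightarrow>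
       \<exists>j. r < (LINT x|lborel. indicator E x * divergence (\<phi> j) x)"
proof -
  define P where "P = {\<phi>::'a \<Rightarrow> 'a. C1 \<phi> \<and> (\<forall>x. norm (\<phi> x) \<le> 1)}"
  have "compact (closure A)" using A by simp
  then obtain Q where Q: "Q \<subseteq> P" "countable Q"
    "\<And>p e. p \<in> P \<Longrightarrow> e > 0 \<Longrightarrow> \<exists>q\<in>Q. \<forall>x\<in>closure A. \<bar>divergence p x - divergence q x\<bar> < e"
    by (rule countable_uniformly_dense[of "closure A" P divergence])
      (auto simp: P_def intro: continuous_on_divergence)
  have "(\<lambda>x. 0) \<in> P" by (simp add: P_def C1_const)
  then have "Q \<noteq> {}" using Q(3)[of "\<lambda>x. 0" 1] by auto
  define \<phi> where "\<phi> = from_nat_into Q"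
  have r: "range \<phi> = Q" unfolding \<phi>_def using \<open>Q \<noteq> {}\<close> Q(2) by (rule range_from_nat_into)
  show ?thesis
  proof
    show C: "C1 (\<phi> j)" "norm (\<phi> j x) \<le> 1" for j x
      using r Q(1) unfolding P_def by blast+
    fix E and r' :: real
    assume E: "E \<subseteq> A" "E \<in> sets borel" and r': "ereal r' < perimeter E"
    have bE: "bounded E" using E A bounded_subset by blast
    obtain p where p: "C1_compact_support p" "\<And>x. norm (p x) \<le> 1" "r' < (LINT x:E|lebesgue. divergence p x)"
      using r' unfolding perimeter_def less_SUP_iff by auto
    have C1p: "C1 p" using p(1) by (simp add: C1_compact_support_iff)
    then have pP: "p \<in> P" using p(2) by (simp add: P_def)
    have peq: "(LINT x:E|lebesgue. divergence p x) = (LINT x|lborel. indicator E x * divergence p x)"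
      by (intro set_lint_lebesgue_eq_lborel E borel_measurable_continuous_onI continuous_on_divergence C1p)
    define e where "e = ((LINT x:E|lebesgue. divergence p x) - r') / (measure lborel E + 1)"
    have m0: "measure lborel E + 1 > 0" by (simp add: add_nonneg_pos)
    have "e > 0" unfolding e_def using p(3) m0 by simp
    obtain q where q: "q \<in> Q" "\<And>x. x \<in> closure A \<Longrightarrow> \<bar>divergence p x - divergence q x\<bar> < e"
      using Q(3)[OF pP \<open>e > 0\<close>] by blast
    have C1q: "C1 q" using q(1) Q(1) by (auto simp: P_def)
    have Ef: "emeasure lborel E < \<infinity>" by (rule emeasure_bounded_finite[OF bE])
    have ip: "integrable lborel (\<lambda>x. indicator E x * divergence p x)"
      and iq: "integrable lborel (\<lambda>x. indicator E x * divergence q x)"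
      and ie: "integrable lborel (\<lambda>x. indicator E x * e)"
      using Ef E(2) by (auto intro!: integrable_indicator_continuous bE continuous_on_divergence C1p C1q continuous_on_const)
    have "(LINT x|lborel. indicator E x * divergence p x) - measure lborel E * e
      = (LINT x|lborel. indicator E x * divergence p x - indicator E x * e)"
      using ip ie E(2) by (simp add: Bochner_Integration.integral_diff)
    also have "\<dots> \<le> (LINT x|lborel. indicator E x * divergence q x)"
    proof (rule integral_mono)
      fix x
      show "indicator E x * divergence p x - indicator E x * e \<le> indicator E x * divergence q x"
        using q(2)[of x] E(1) closure_subset[of A] by (auto simp: indicator_def abs_less_iff subset_eq)
    qed (use ip ie iq in auto)
    finally have "(LINT x|lborel. indicator E x * divergence p x) - measure lborel E * e
      \<le> (LINT x|lborel. indicator E x * divergence q x)" .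
    moreover have "measure lborel E * e < (measure lborel E + 1) * e"
      using \<open>e > 0\<close> by simp
    moreover have "(measure lborel E + 1) * e = (LINT x|lborel. indicator E x * divergence p x) - r'"
      unfolding e_def peq using m0 by simp
    ultimately have "r' < (LINT x|lborel. indicator E x * divergence q x)"
      by linarith
    moreover obtain j where "\<phi> j = q" using q(1) r by (metis imageE)
    ultimately show "\<exists>j. r' < (LINT x|lborel. indicator E x * divergence (\<phi> j) x)"
      by blast
  qed
qed

text \<open>
  One \<open>C1\<close> field \<open>X\<close> on the product which, for all \<open>t\<close> outside a set of small measure, coincides on
  the fibre over \<open>t\<close> with one of the fields \<open>\<phi> j\<close> such that \<open>t \<in> A j\<close>. It arises by successive convex
  combinations \<open>\<psi> \<phi>\<^sub>n + (1 - \<psi>) X\<close> with \<open>\<psi>\<close> close to the indicator of \<open>A n\<close>: convexity preserves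
  both the bound 1 on the norm and the bound \<open>b\<close> on the horizontal divergence. The latter does not
  depend on \<open>\<eta>\<close>, so the exceptional set can be made harmless afterwards.
\<close>

lemma selected_test_fields:
  fixes \<phi> :: "nat \<Rightarrow> 'a::euclidean_space \<Rightarrow> 'a" and A :: "nat \<Rightarrow> real set"
  assumes \<phi>: "\<And>j. C1 (\<phi> j)" "\<And>j x. norm (\<phi> j x) \<le> 1"
    and A: "\<And>j. bounded (A j)" "\<And>j. A j \<in> sets borel"
    and b: "b \<ge> 0" "\<And>j x. j < n \<Longrightarrow> x \<in> W \<Longrightarrow> \<bar>divergence (\<phi> j) x\<bar> \<le> b"
    and "\<eta> > 0"
  shows "\<exists>(X :: 'a \<times> real \<Rightarrow> 'a) R. C1 X \<and> (\<forall>z. norm (X z) \<le> 1) \<and>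
    R \<in> sets borel \<and> emeasure lborel R < ennreal \<eta> \<and>
    (\<forall>t. t \<notin> R \<longrightarrow> (\<exists>j<n. t \<in> A j \<and> (\<forall>x. X (x, t) = \<phi> j x)) \<or>
                    (t \<notin> (\<Union>j<n. A j) \<and> (\<forall>x. X (x, t) = 0))) \<and>
    (\<forall>t. \<forall>x\<in>W. \<bar>divergence (\<lambda>x. X (x, t)) x\<bar> \<le> b)"
  using b(2) \<open>\<eta> > 0\<close>
proof (induction n arbitrary: \<eta>)
  case 0
  show ?case
    by (rule exI[of _ "\<lambda>_. 0"], rule exI[of _ "{}"]) (use 0 b(1) in \<open>auto simp: C1_const divergence_const\<close>)
next
  case (Suc n)
  obtain X R where X: "C1 X" "\<And>z. norm (X z) \<le> 1"
    and R: "R \<in> sets borel" "emeasure lborel R < ennreal (\<eta> / 2)"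
    and XR: "\<And>t. t \<notin> R \<Longrightarrow> (\<exists>j<n. t \<in> A j \<and> (\<forall>x. X (x, t) = \<phi> j x)) \<or>
                    (t \<notin> (\<Union>j<n. A j) \<and> (\<forall>x. X (x, t) = 0))"
    and Xb: "\<And>t x. x \<in> W \<Longrightarrow> \<bar>divergence (\<lambda>x. X (x, t)) x\<bar> \<le> b"
    using Suc.IH[of "\<eta> / 2"] Suc.prems by auto
  obtain \<psi> :: "real \<Rightarrow> real" and T where \<psi>: "C1 \<psi>" "\<And>t. 0 \<le> \<psi> t" "\<And>t. \<psi> t \<le> 1"
    and T: "T \<in> sets borel" "emeasure lborel T < ennreal (\<eta> / 2)" "\<And>t. t \<notin> T \<Longrightarrow> \<psi> t = indicator (A n) t"
    using C1_approx_indicator[OF A, of "\<eta> / 2" n] Suc.prems(2) by auto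
  define X' where "X' z = \<psi> (snd z) *\<^sub>R \<phi> n (fst z) + (1 - \<psi> (snd z)) *\<^sub>R X z" for z
  have X't: "(\<lambda>x. X' (x, t)) = (\<lambda>x. \<psi> t *\<^sub>R \<phi> n x + (1 - \<psi> t) *\<^sub>R X (x, t))" for t
    by (simp add: X'_def)
  show ?case
  proof (intro exI[of _ X'] exI[of _ "R \<union> T"] conjI allI impI ballI)
    show "C1 X'"
      unfolding X'_def
      by (intro C1_add C1_scaleR C1_diff C1_const X C1_compose[OF \<psi>(1) C1_snd] C1_compose[OF \<phi>(1) C1_fst])
    show "norm (X' z) \<le> 1" for z
    proof -
      have "norm (X' z) \<le> \<psi> (snd z) * 1 + (1 - \<psi> (snd z)) * 1"
        unfolding X'_def
        using \<psi>(2,3)[of "snd z"] \<phi>(2)[of n "fst z"] X(2)[of z]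
        by (intro norm_triangle_le add_mono) (simp_all add: mult_left_le)
      then show ?thesis by simp
    qed
    show "R \<union> T \<in> sets borel" using R T by simp
    have "emeasure lborel (R \<union> T) \<le> emeasure lborel R + emeasure lborel T"
      by (rule emeasure_subadditive) (use R T in auto)
    also have "\<dots> < ennreal (\<eta> / 2) + ennreal (\<eta> / 2)"
      using R(2) T(2) by (rule add_strict_mono)
    also have "\<dots> = ennreal \<eta>"
      using Suc.prems by (simp flip: ennreal_plus)
    finally show "emeasure lborel (R \<union> T) < ennreal \<eta>" .
    fix t
    show "(\<exists>j<Suc n. t \<in> A j \<and> (\<forall>x. X' (x, t) = \<phi> j x)) \<or>
          (t \<notin> (\<Union>j<Suc n. A j) \<and> (\<forall>x. X' (x, t) = 0))" if "t \<notin> R \<union> T"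
    proof (cases "t \<in> A n")
      case True
      then have "X' (x, t) = \<phi> n x" for x
        using T(3)[of t] that by (simp add: X'_def)
      with True show ?thesis by blast
    next
      case False
      then have "X' (x, t) = X (x, t)" for x
        using T(3)[of t] that by (simp add: X'_def)
      with XR[of t] that False show ?thesis by (auto simp: less_Suc_eq)
    qed
    fix x assume x: "x \<in> W"
    have "divergence (\<lambda>x. X' (x, t)) x = \<psi> t * divergence (\<phi> n) x + (1 - \<psi> t) * divergence (\<lambda>x. X (x, t)) x"
      unfolding X't using C1_slice_fst[OF X(1)] \<phi>(1)
      by (subst divergence_add) (auto intro!: C1_scaleR C1_const simp: divergence_scaleR)
    also have "\<bar>\<dots>\<bar> \<le> \<psi> t * b + (1 - \<psi> t) * b"
      by (rule order_trans[OF abs_triangle_ineq], unfold abs_mult, intro add_mono mult_mono)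
        (use Suc.prems(1)[of n x] Xb[OF x, of t] \<psi>(2,3)[of t] x b(1) in auto)
    finally show "\<bar>divergence (\<lambda>x. X' (x, t)) x\<bar> \<le> b" by (simp add: algebra_simps)
  qed
qed

text \<open>
  The vertical component of the test field: a monotone transition from \<open>-1/2\<close> to \<open>0\<close> near the interval
  \<open>[c, d)\<close> whose slope is almost entirely concentrated on \<open>S\<close>. The slope is a multiple of a
  Urysohn function \<open>\<psi>\<close> for a compact \<open>K \<subseteq> S\<close> of positive measure in an open set \<open>U\<close> whose measure
  exceeds that of \<open>K\<close> by a factor of at most \<open>1 + \<epsilon>\<close>.
\<close>

lemma C1_concentrated_rise:
  fixes S :: "real set"
  assumes S: "S \<in> sets borel" "S \<subseteq> {c..<d}" "emeasure lborel S > 0" and "\<epsilon> > 0"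
  obtains g where "C1 g" "\<And>t. - (1/2) \<le> g t" "\<And>t. g t \<le> 0" "\<And>t. 0 \<le> deriv g t"
    "\<And>t. t \<le> c - \<epsilon> \<Longrightarrow> g t = - (1/2)" "\<And>t. t \<ge> d + \<epsilon> \<Longrightarrow> g t = 0"
    "(LINT t|lborel. indicator S t * deriv g t) \<ge> 1/2 - \<epsilon>"
proof -
  have bS: "bounded S" by (rule bounded_subset[OF bounded_closed_interval[of c d]]) (use S in auto)
  have Sf: "emeasure lborel S < \<infinity>" by (rule emeasure_bounded_finite[OF bS])
  obtain K where K: "closed K" "K \<subseteq> S" "S - K \<in> lmeasurable" "emeasure lebesgue (S - K) < emeasure lborel S"
  proof -
    have SL: "S \<in> sets lebesgue" using S by simp
    have eS: "emeasure lborel S = ennreal (measure lborel S)"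
      using Sf by (simp add: emeasure_eq_ennreal_measure)
    with S(3) have "measure lborel S > 0"
      by (metis ennreal_less_zero_iff)
    from sets_lebesgue_inner_closed[OF SL this] show ?thesis
      using that unfolding eS by blast
  qed
  have [measurable]: "K \<in> sets borel" "S \<in> sets borel" using K S by auto
  have bK: "bounded K" by (rule bounded_subset[OF bS K(2)])
  then have cK: "compact K" using K(1) compact_eq_bounded_closed by blast
  have Kf: "emeasure lborel K < \<infinity>" by (rule emeasure_bounded_finite[OF bK])
  define k where "k = measure lborel K"
  have Kk: "emeasure lborel K = ennreal k"
    unfolding k_def using Kf by (simp add: emeasure_eq_ennreal_measure)
  have "k > 0"
  proof -
    have "emeasure lborel K \<noteq> 0"
    proof
      assume "emeasure lborel K = 0"
      then have "emeasure lborel (S - K) = emeasure lborel S"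
        by (intro emeasure_Diff_null_set) (auto simp: null_sets_def)
      moreover have "emeasure lebesgue (S - K) = emeasure lborel (S - K)"
        by simp
      ultimately show False using K(4) by simp
    qed
    then show ?thesis using Kk by (metis ennreal_neg linorder_not_less k_def measure_nonneg less_eq_real_def ennreal_0)
  qed
  obtain U' where U': "open U'" "K \<subseteq> U'" "U' - K \<in> lmeasurable" "emeasure lebesgue (U' - K) < ennreal (\<epsilon> * k)"
    using sets_lebesgue_outer_open[of K "\<epsilon> * k"] \<open>\<epsilon> > 0\<close> \<open>k > 0\<close> by auto
  define U where "U = U' \<inter> {c-\<epsilon><..<d+\<epsilon>}"
  have U: "open U" "K \<subseteq> U" "U \<subseteq> {c-\<epsilon><..<d+\<epsilon>}"
    unfolding U_def using U' K S \<open>\<epsilon> > 0\<close> by force+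
  have [measurable]: "U \<in> sets borel" "U' \<in> sets borel" using U(1) U'(1) by auto
  have bU: "bounded U" by (rule bounded_subset[OF bounded_closed_interval[of "c - \<epsilon>" "d + \<epsilon>"]]) (use U(3) in auto)
  have Uk: "measure lborel U \<le> (1 + \<epsilon>) * k"
  proof -
    have "emeasure lborel U \<le> emeasure lborel (K \<union> (U' - K))"
      by (rule emeasure_mono) (auto simp: U_def)
    also have "\<dots> \<le> emeasure lborel K + emeasure lborel (U' - K)"
      by (rule emeasure_subadditive) auto
    also have "emeasure lborel (U' - K) = emeasure lebesgue (U' - K)" by simp
    also have "emeasure lborel K + emeasure lebesgue (U' - K) \<le> ennreal k + ennreal (\<epsilon> * k)"
      unfolding Kk using U'(4) by (intro add_left_mono) simp
    also have "\<dots> = ennreal ((1 + \<epsilon>) * k)"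
      using \<open>\<epsilon> > 0\<close> \<open>k > 0\<close> by (simp add: algebra_simps flip: ennreal_plus)
    finally show ?thesis
      unfolding measure_def using \<open>\<epsilon> > 0\<close> \<open>k > 0\<close> by (intro enn2real_leI) auto
  qed
  obtain \<psi> :: "real \<Rightarrow> real" where \<psi>: "C1 \<psi>" "\<And>x. 0 \<le> \<psi> x" "\<And>x. \<psi> x \<le> 1"
    "\<And>x. x \<in> K \<Longrightarrow> \<psi> x = 1" "\<And>x. x \<notin> U \<Longrightarrow> \<psi> x = 0"
    using C1_urysohn[OF cK U(1,2)] by metis
  have \<psi>c: "continuous_on A \<psi>" for A by (rule C1_continuous[OF \<psi>(1)])
  have [measurable]: "\<psi> \<in> borel_measurable borel" by (rule borel_measurable_continuous_onI[OF \<psi>c])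
  have \<psi>0: "\<psi> s = 0" if "s \<le> c - \<epsilon> \<or> s \<ge> d + \<epsilon>" for s
    by (rule \<psi>(5)) (use U(3) that in auto)
  have i\<psi>: "integrable lborel \<psi>"
  proof -
    have "integrable lborel (\<lambda>x. indicator U x * \<psi> x)"
      by (rule integrable_indicator_continuous) (use bU \<psi>c in auto)
    moreover have "(\<lambda>x. indicator U x * \<psi> x) = \<psi>"
      using \<psi>(5) by (auto simp: fun_eq_iff indicator_def)
    ultimately show ?thesis by simp
  qed
  have i\<psi>A: "integrable lborel (\<lambda>x. indicator A x * \<psi> x)" if "A \<in> sets borel" for A
    using integrable_mult_indicator[of A lborel \<psi>] i\<psi> that by simp
  define I where "I = (LINT s|lborel. \<psi> s)"
  have "(LINT s|lborel. indicator K s * \<psi> s) = (LINT s|lborel. indicator K s)"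
    by (rule Bochner_Integration.integral_cong) (use \<psi>(4) in \<open>auto simp: indicator_def\<close>)
  then have IK: "(LINT s|lborel. indicator K s * \<psi> s) = k"
    by (simp add: k_def)
  have KS: "(LINT s|lborel. indicator S s * \<psi> s) \<ge> k"
    unfolding IK[symmetric]
    by (intro integral_mono i\<psi>A) (use K(2) \<psi>(2) in \<open>auto simp: indicator_def\<close>)
  have IS: "I \<ge> (LINT s|lborel. indicator S s * \<psi> s)"
    unfolding I_def
    by (intro integral_mono i\<psi>A i\<psi>) (use \<psi>(2) in \<open>auto simp: indicator_def\<close>)
  have "I > 0" using IS KS \<open>k > 0\<close> by linarith
  have IU: "I \<le> (1 + \<epsilon>) * k"
  proof -
    have "I \<le> (LINT s|lborel. indicator U s)"
      unfolding I_def
    proof (rule integral_mono[OF i\<psi>])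
      show "integrable lborel (indicator U :: real \<Rightarrow> real)"
        using emeasure_bounded_finite[OF bU] by simp
      show "\<psi> s \<le> indicator U s" for s
        using \<psi>(3,5)[of s] by (auto simp: indicator_def)
    qed
    then show ?thesis using Uk by simp
  qed
  define J where "J t = (LINT s|lborel. indicator {..t} s * \<psi> s)" for t
  have J0: "J t \<ge> 0" for t
    unfolding J_def by (rule integral_nonneg_AE) (use \<psi>(2) in auto)
  have JI: "J t \<le> I" for t
    unfolding J_def I_def
    by (intro integral_mono i\<psi>A i\<psi>) (use \<psi>(2) in \<open>auto simp: indicator_def\<close>)
  have dJ: "(J has_real_derivative \<psi> t) (at t)" for t
  proof -
    \<comment> \<open>Any starting point to the left of both \<open>t\<close> and the support of \<open>\<psi>\<close> will do.\<close>
    define a where "a = min (c - \<epsilon>) (t - 1)"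
    have \<psi>a: "\<psi> s = 0" if "\<not> a \<le> s" for s
      by (rule \<psi>0) (use that in \<open>auto simp: a_def\<close>)
    have Ja: "J u = integral {a..u} \<psi>" for u
    proof -
      have "J u = (LINT s:{a..u}|lborel. \<psi> s)"
        unfolding J_def set_lebesgue_integral_def
        by (rule Bochner_Integration.integral_cong) (use \<psi>a in \<open>auto simp: indicator_def\<close>)
      also have "\<dots> = integral {a..u} \<psi>"
        by (rule set_borel_integral_eq_integral) (use i\<psi>A in \<open>simp add: set_integrable_def\<close>)
      finally show ?thesis .
    qed
    have "((\<lambda>u. integral {a..u} \<psi>) has_real_derivative \<psi> t) (at t within {a..t+1})"
      by (rule integral_has_real_derivative[OF \<psi>c]) (auto simp: a_def)
    moreover have "at t within {a..t+1} = at t"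
      by (rule at_within_Icc_at) (auto simp: a_def)
    ultimately show ?thesis unfolding Ja by simp
  qed
  define g where "g t = - (1/2) + J t / (2 * I)" for t
  have dg: "(g has_real_derivative \<psi> t / (2 * I)) (at t)" for t
    unfolding g_def using \<open>I > 0\<close> by (auto intro!: derivative_eq_intros dJ)
  then have deg: "deriv g t = \<psi> t / (2 * I)" for t
    by (rule DERIV_imp_deriv)
  show ?thesis
  proof (rule that[of g])
    have "2 * I \<noteq> 0" using \<open>I > 0\<close> by simp
    then have "continuous_on UNIV (\<lambda>t. \<psi> t / (2 * I))"
      by (intro continuous_on_divide \<psi>c continuous_on_const) simp
    with dg show "C1 g" by (rule C1_real)
    show "- (1/2) \<le> g t" "g t \<le> 0" "0 \<le> deriv g t" for t
      using J0[of t] JI[of t] \<open>I > 0\<close> \<psi>(2)[of t] by (auto simp: g_def deg field_simps)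
    show "g t = - (1/2)" if "t \<le> c - \<epsilon>" for t
    proof -
      have "indicator {..t} s * \<psi> s = 0" for s
        using that \<psi>0[of s] by (auto simp: indicator_def)
      then have "J t = 0" unfolding J_def by (simp only: Bochner_Integration.integral_zero)
      then show ?thesis by (simp add: g_def)
    qed
    show "g t = 0" if "t \<ge> d + \<epsilon>" for t
    proof -
      have "indicator {..t} s * \<psi> s = \<psi> s" for s
        using that \<psi>0[of s] by (auto simp: indicator_def)
      then have "J t = I" unfolding J_def I_def by (simp only:)
      then show ?thesis using \<open>I > 0\<close> by (simp add: g_def)
    qed
    have "1/2 - \<epsilon> \<le> 1 / (2 * (1 + \<epsilon>))"
      using \<open>\<epsilon> > 0\<close> by (simp add: field_simps)
    also have "\<dots> = k / (2 * ((1 + \<epsilon>) * k))"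
      using \<open>k > 0\<close> by simp
    also have "\<dots> \<le> (LINT s|lborel. indicator S s * \<psi> s) / (2 * I)"
      by (rule frac_le) (use KS IU \<open>I > 0\<close> \<open>k > 0\<close> in auto)
    also have "\<dots> = (LINT t|lborel. indicator S t * deriv g t)"
      by (simp add: deg)
    finally show "(LINT t|lborel. indicator S t * deriv g t) \<ge> 1/2 - \<epsilon>" .
  qed
qed

section \<open>Lower bound for the perimeter in terms of the fibres\<close>

definition fiber :: "('a \<times> real) set \<Rightarrow> real \<Rightarrow> 'a set" where
  "fiber F t = {x. (x, t) \<in> F}"

lemma fiber_borel:
  fixes F :: "('a::euclidean_space \<times> real) set"
  assumes "F \<in> sets borel"
  shows "fiber F t \<in> sets borel"
proof -
  have "(\<lambda>x::'a. (x, t)) \<in> borel_measurable borel"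
    by (intro borel_measurable_continuous_onI continuous_intros)
  from measurable_sets[OF this assms] show ?thesis
    by (simp add: vimage_def fiber_def)
qed

lemma indicator_fiber: "indicator F (x, t) = indicator (fiber F t) x"
  by (simp add: indicator_def fiber_def)

lemma fubini_fibers:
  fixes F :: "('a::euclidean_space \<times> real) set" and f :: "'a \<times> real \<Rightarrow> real"
  assumes F: "bounded F" "F \<in> sets borel" and f: "continuous_on UNIV f"
  shows "integrable lborel (\<lambda>t. LINT x|lborel. indicator (fiber F t) x * f (x, t))"
    and "(LINT z|lborel. indicator F z * f z) =
      (LINT t|lborel. LINT x|lborel. indicator (fiber F t) x * f (x, t))"
proof -
  have i: "integrable (lborel \<Otimes>\<^sub>M lborel) (\<lambda>(x, t). indicator F (x, t) * f (x, t))"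
    unfolding lborel_prod using integrable_indicator_continuous[OF F(2,1) f] by (simp add: case_prod_unfold)
  show "integrable lborel (\<lambda>t. LINT x|lborel. indicator (fiber F t) x * f (x, t))"
    using lborel_pair.integrable_snd[OF i] by (simp add: indicator_fiber)
  show "(LINT z|lborel. indicator F z * f z) =
      (LINT t|lborel. LINT x|lborel. indicator (fiber F t) x * f (x, t))"
    using lborel_pair.integral_snd[OF i] unfolding lborel_prod
    by (simp add: fiber_def indicator_def case_prod_unfold)
qed

text \<open>
  A discrete substitute for the essential infimum of \<open>S\<close>: almost nothing of \<open>S\<close> lies to the left of
  the first cell of the grid of mesh \<open>e\<close> that meets \<open>S\<close> in positive measure.
\<close>

lemma first_nonnull_cell:
  fixes S :: "real set"
  assumes S: "S \<in> sets borel" "S \<subseteq> {0<..}" "emeasure lborel S > 0" and e: "e > 0"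
  obtains k :: nat where "emeasure lborel (S \<inter> {e * real k..<e * (real k + 1)}) > 0"
    "S \<inter> {..<e * real k} \<in> null_sets lborel"
proof -
  note [measurable] = S(1)
  define cell where "cell j = S \<inter> {e * real j..<e * (real j + 1)}" for j :: nat
  have [measurable]: "cell j \<in> sets borel" for j unfolding cell_def by measurable
  have cell: "\<exists>j. t \<in> cell j \<and> real j \<le> t / e" if "t \<in> S" for t
  proof -
    have "t > 0" using S(2) that by auto
    define j where "j = nat \<lfloor>t / e\<rfloor>"
    have "real j = \<lfloor>t / e\<rfloor>" using \<open>t > 0\<close> e by (simp add: j_def)
    then have j: "real j \<le> t / e" "t / e < real j + 1" by linarith+
    then have "e * real j \<le> t" "t < e * (real j + 1)" using e by (auto simp: field_simps)
    with that j(1) show ?thesis unfolding cell_def by auto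
  qed
  have "\<exists>j. emeasure lborel (cell j) \<noteq> 0"
  proof (rule ccontr)
    assume "\<not> ?thesis"
    then have "(\<Union>j. cell j) \<in> null_sets lborel"
      by (intro null_sets_UN) (auto simp: null_sets_def)
    moreover have "S \<subseteq> (\<Union>j. cell j)" using cell by blast
    ultimately have "emeasure lborel S = 0"
      using emeasure_mono[of S "\<Union>j. cell j" lborel] by (simp add: null_sets_def)
    then show False using S(3) by simp
  qed
  then obtain k where k: "emeasure lborel (cell k) \<noteq> 0" "\<And>j. j < k \<Longrightarrow> emeasure lborel (cell j) = 0"
    using exists_least_iff[of "\<lambda>j. emeasure lborel (cell j) \<noteq> 0"] by blast
  have "S \<inter> {..<e * real k} \<subseteq> (\<Union>j<k. cell j)"
  proof
    fix t assume t: "t \<in> S \<inter> {..<e * real k}"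
    then obtain j where j: "t \<in> cell j" "real j \<le> t / e" using cell by blast
    have "t / e < real k" using t e by (simp add: field_simps)
    with j(2) have "real j < real k" by linarith
    with j(1) show "t \<in> (\<Union>j<k. cell j)" by auto
  qed
  moreover have "(\<Union>j<k. cell j) \<in> null_sets lborel"
    by (intro null_sets_UN') (auto simp: null_sets_def k(2))
  ultimately have "S \<inter> {..<e * real k} \<in> null_sets lborel"
    by (rule null_sets_subset[rotated 2]) auto
  with k(1) show ?thesis
    using that[of k] unfolding cell_def by (simp add: zero_less_iff_neq_zero)
qed

text \<open>
  The heart of the argument. Suppose every subset \<open>E\<close> of \<open>A\<close> satisfies \<open>P(E) \<ge> H \<bar>E\<bar>\<close>, with an extra
  factor 2 if \<open>\<bar>E\<bar> \<le> \<delta>\<close>, and let \<open>m t\<close> be the measure of the fibre of \<open>F\<close> over \<open>t\<close>. Let \<open>c\<close> be, up to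
  a small error \<open>e\<close>, the first time at which \<open>m\<close> exceeds \<open>\<delta>\<close>. The test field has vertical component
  \<open>g t\<close>, rising from \<open>-1/2\<close> to \<open>0\<close> around \<open>c\<close> with slope concentrated on \<open>{m > \<delta>}\<close>, and horizontal
  component \<open>(1 - g\<^sup>2) X\<close>, where \<open>X\<close> is nearly optimal for the fibres. The norm is at most 1 since
  \<open>(1 - g\<^sup>2)\<^sup>2 + g\<^sup>2 \<le> 1\<close>. The vertical part contributes the integral of \<open>m g'\<close>, that is, nearly \<open>\<delta> / 2\<close>.
  The horizontal part still contributes \<open>H \<bar>F\<bar>\<close>: after \<open>c\<close> the factor \<open>1 - g\<^sup>2\<close> is 1, and before \<open>c\<close> it
  is \<open>3/4\<close>, which the factor 2 available for small fibres outweighs. Around \<open>c\<close> itself nothing is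
  gained, but that interval has length \<open>3 e\<close>.
\<close>

lemma perimeter_lower_bound_by_fibers:
  fixes F :: "('a::euclidean_space \<times> real) set"
  assumes A: "bounded A" and F: "F \<in> sets borel" "F \<subseteq> A \<times> {0<..<L}" and L: "L > 0" and H: "H \<ge> 0"
    and PA: "\<And>E. E \<subseteq> A \<Longrightarrow> E \<in> sets borel \<Longrightarrow> ereal (H * measure lborel E) \<le> perimeter E"
    and P\<delta>: "\<And>E. E \<subseteq> A \<Longrightarrow> E \<in> sets borel \<Longrightarrow> measure lborel E \<le> \<delta> \<Longrightarrow>
      ereal (2 * H * measure lborel E) \<le> perimeter E"
    and \<delta>: "\<delta> \<ge> 0" and S0: "emeasure lborel {t. \<delta> < measure lborel (fiber F t)} > 0"
  shows "ereal (H * measure lborel F + \<delta> / 2) \<le> perimeter F"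
proof -
  define m where "m t = measure lborel (fiber F t)" for t
  obtain V where V0: "V \<ge> 0" and V: "\<And>E. E \<subseteq> A \<Longrightarrow> E \<in> sets borel \<Longrightarrow> measure lborel E \<le> V"
  proof -
    obtain R where "A \<subseteq> ball 0 R" using A bounded_subset_ballD by blast
    then have "measure lborel E \<le> measure lborel (ball (0::'a) R)" if "E \<subseteq> A" "E \<in> sets borel" for E
      using that emeasure_bounded_finite[OF bounded_ball, of "0::'a" R]
      by (intro measure_mono_fmeasurable) (auto simp: fmeasurable_def)
    then show ?thesis using that measure_nonneg by blast
  qed
  have bF: "bounded F"
    by (rule bounded_subset[OF bounded_Times[OF A, of "{0<..<L}"] F(2)])
      (rule bounded_subset[OF bounded_closed_interval[of 0 L]], auto)
  have fA: "fiber F t \<subseteq> A" for t using F(2) by (auto simp: fiber_def)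
  have fb: "fiber F t \<in> sets borel" for t by (rule fiber_borel[OF F(1)])
  have bf: "bounded (fiber F t)" for t by (rule bounded_subset[OF A fA])
  have f0: "fiber F t = {}" if "t \<notin> {0<..<L}" for t using F(2) that by (auto simp: fiber_def)
  have ff: "emeasure lborel (fiber F t) < \<infinity>" for t by (rule emeasure_bounded_finite[OF bf])
  have mV: "m t \<le> V" and m0: "m t \<ge> 0" for t
    unfolding m_def using V[OF fA fb] by auto
  have mo: "m t = 0" if "t \<notin> {0<..<L}" for t using f0[OF that] by (simp add: m_def)
  have meq: "(LINT x|lborel. indicator (fiber F t) x * c) = m t * c" for t c
    using fb ff by (simp add: m_def)
  have im: "integrable lborel m" and Fm: "measure lborel F = (LINT t|lborel. m t)"
    using fubini_fibers[OF bF F(1), of "\<lambda>_. 1"] F(1) by (simp_all add: m_def[abs_def] fb)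
  have [measurable]: "m \<in> borel_measurable borel" using im by simp
  define S where "S = {t. \<delta> < m t}"
  have [measurable]: "S \<in> sets borel" unfolding S_def by measurable
  have SL: "S \<subseteq> {0<..<L}" using mo \<delta> unfolding S_def by force
  have S0': "emeasure lborel S > 0" using S0 unfolding S_def m_def .
  obtain \<phi> :: "nat \<Rightarrow> 'a \<Rightarrow> 'a" where \<phi>: "\<And>j. C1 (\<phi> j)" "\<And>j x. norm (\<phi> j x) \<le> 1"
    and \<phi>P: "\<And>E r. E \<subseteq> A \<Longrightarrow> E \<in> sets borel \<Longrightarrow> ereal r < perimeter E \<Longrightarrow>
       \<exists>j. r < (LINT x|lborel. indicator E x * divergence (\<phi> j) x)"
    using countable_test_fields[OF A] by metis
  define D where "D j t = (LINT x|lborel. indicator (fiber F t) x * divergence (\<phi> j) x)" for j t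
  have [measurable]: "D j \<in> borel_measurable borel" for j
  proof -
    have "continuous_on UNIV (\<lambda>z::'a \<times> real. divergence (\<phi> j) (fst z))"
      by (rule continuous_on_compose2[OF continuous_on_divergence[OF \<phi>(1), of UNIV]]) (auto intro: continuous_on_fst continuous_on_id)
    from fubini_fibers(1)[OF bF F(1) this] show ?thesis
      unfolding D_def by simp
  qed
  \<comment> \<open>The claim up to an error proportional to \<open>e\<close>, with a constant independent of \<open>e\<close>.\<close>
  have almost: "H * measure lborel F + \<delta> / 2 \<le> p + (\<delta> + L + 4 * H * V + 1) * e"
    if p: "perimeter F \<le> ereal p" and e: "e > 0" for p e
  proof -
    have "S \<subseteq> {0<..}" using SL by auto
    then obtain k :: nat where k: "emeasure lborel (S \<inter> {e * real k..<e * (real k + 1)}) > 0"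
      and kN: "S \<inter> {..<e * real k} \<in> null_sets lborel"
      using first_nonnull_cell[OF _ _ S0' e] by (metis \<open>S \<in> sets borel\<close>)
    define c where "c = e * real k"
    define d where "d = e * (real k + 1)"
    have dc: "d = c + e" by (simp add: c_def d_def algebra_simps)
    define N where "N = S \<inter> {..<c}"
    have N0: "N \<in> null_sets lborel" unfolding N_def c_def by (rule kN)
    have [measurable]: "N \<in> sets borel" unfolding N_def by measurable
    obtain g where g: "C1 g" "\<And>t. - (1/2) \<le> g t" "\<And>t. g t \<le> 0" "\<And>t. 0 \<le> deriv g t"
      "\<And>t. t \<le> c - e \<Longrightarrow> g t = - (1/2)" "\<And>t. t \<ge> d + e \<Longrightarrow> g t = 0"
      and gS: "(LINT t|lborel. indicator (S \<inter> {c..<d}) t * deriv g t) \<ge> 1/2 - e"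
      by (rule C1_concentrated_rise[of "S \<inter> {c..<d}" c d e]) (use k e in \<open>auto simp: c_def d_def\<close>)
    define \<alpha> where "\<alpha> t = 1 - (g t)\<^sup>2" for t
    have C\<alpha>: "C1 \<alpha>" unfolding \<alpha>_def power2_eq_square by (intro C1_diff C1_const C1_mult g)
    have gsq: "(g t)\<^sup>2 \<le> 1/4" for t
      using power_mono[of "- g t" "1/2" 2] g(2,3)[of t] by (simp add: power2_eq_square)
    have \<alpha>01: "0 \<le> \<alpha> t" "\<alpha> t \<le> 1" for t using gsq[of t] by (auto simp: \<alpha>_def)
    have [measurable]: "\<alpha> \<in> borel_measurable borel"
      by (rule borel_measurable_continuous_onI[OF C1_continuous[OF C\<alpha>]])
    \<comment> \<open>\<open>Z\<close> is the transition zone of \<open>g\<close>; \<open>Aj j\<close> collects the times at which \<open>\<phi> j\<close> is good enough.\<close>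
    define Z where "Z = {c - e..d + e}"
    define Aj where "Aj j = {t. 0 < t \<and> t < L \<and> H * m t - e \<le> \<alpha> t * D j t}" for j
    have Ajb[measurable]: "Aj j \<in> sets borel" for j unfolding Aj_def by measurable
    have bAj: "bounded (Aj j)" for j
      by (rule bounded_subset[OF bounded_closed_interval[of 0 L]]) (auto simp: Aj_def)
    define T where "T = {0<..<L} - Z - N"
    have [measurable]: "T \<in> sets borel" unfolding T_def Z_def by measurable
    have cover: "\<exists>j. t \<in> Aj j" if "t \<in> T" for t
    proof -
      have t: "0 < t" "t < L" "t \<notin> N" "t \<notin> Z" using that by (auto simp: T_def)
      consider "t > d + e" | "t < c - e" using t(4) unfolding Z_def by force
      then show ?thesis
      proof cases
        case 1
        then have "\<alpha> t = 1" using g(6)[of t] by (simp add: \<alpha>_def)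
        have "ereal (H * m t - e) < ereal (H * m t)" using e by simp
        also have "\<dots> \<le> perimeter (fiber F t)" using PA[OF fA fb] by (simp add: m_def)
        finally obtain j where "H * m t - e < D j t"
          using \<phi>P[OF fA fb] unfolding D_def by blast
        then show ?thesis using t \<open>\<alpha> t = 1\<close> by (auto simp: Aj_def intro!: exI[of _ j])
      next
        case 2
        then have "\<alpha> t = 3/4" using g(5)[of t] by (simp add: \<alpha>_def power2_eq_square)
        have "m t \<le> \<delta>" using t(3) 2 e by (simp add: N_def S_def)
        have "ereal (2 * H * m t - e) < ereal (2 * H * m t)" using e by simp
        also have "\<dots> \<le> perimeter (fiber F t)" using P\<delta>[OF fA fb] \<open>m t \<le> \<delta>\<close> by (simp add: m_def)
        finally obtain j where j: "2 * H * m t - e < D j t"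
          using \<phi>P[OF fA fb] unfolding D_def by blast
        have "H * m t \<ge> 0" using H m0 by simp
        with j have "H * m t - e \<le> 3/4 * D j t" using e by linarith
        then have "t \<in> Aj j" using t(1,2) by (simp add: Aj_def \<open>\<alpha> t = 3/4\<close>)
        then show ?thesis ..
      qed
    qed
    obtain n where n: "emeasure lborel (T - (\<Union>j<n. Aj j)) < ennreal e"
    proof -
      have Tf: "emeasure lborel T < \<infinity>"
        by (rule emeasure_bounded_finite, rule bounded_subset[OF bounded_closed_interval[of 0 L]]) (auto simp: T_def)
      have "(\<lambda>n. emeasure lborel (T - (\<Union>j<n. Aj j))) \<longlonglongrightarrow> emeasure lborel (\<Inter>n. T - (\<Union>j<n. Aj j))"
      proof (rule Lim_emeasure_decseq)
        show "emeasure lborel (T - (\<Union>j<n. Aj j)) \<noteq> \<infinity>" for n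
          using emeasure_mono[of "T - (\<Union>j<n. Aj j)" T lborel] Tf by (auto simp: top_unique)
        show "decseq (\<lambda>n. T - (\<Union>j<n. Aj j))"
          unfolding decseq_def by fastforce
      qed auto
      moreover have "(\<Inter>n. T - (\<Union>j<n. Aj j)) = {}"
        using cover by blast
      ultimately have "(\<lambda>n. emeasure lborel (T - (\<Union>j<n. Aj j))) \<longlonglongrightarrow> 0"
        by (simp only: emeasure_empty)
      then have "eventually (\<lambda>n. emeasure lborel (T - (\<Union>j<n. Aj j)) < ennreal e) sequentially"
        by (rule order_tendstoD) (use e in simp)
      then show ?thesis using that eventually_happens' sequentially_bot by blast
    qed
    obtain b where b: "b \<ge> 0" "\<And>j x. j < n \<Longrightarrow> x \<in> A \<Longrightarrow> \<bar>divergence (\<phi> j) x\<bar> \<le> b"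
    proof -
      have "\<exists>c\<ge>0. \<forall>x\<in>A. \<bar>divergence (\<phi> j) x\<bar> \<le> c" for j
      proof -
        have "bounded (divergence (\<phi> j) ` closure A)"
          by (rule compact_imp_bounded, rule compact_continuous_image)
            (use A continuous_on_divergence[OF \<phi>(1)] in auto)
        then obtain c where "c > 0" "\<forall>y\<in>divergence (\<phi> j) ` closure A. norm y \<le> c"
          using bounded_pos by blast
        then show ?thesis using closure_subset[of A] by (intro exI[of _ c]) auto
      qed
      then obtain c where c: "\<And>j. c j \<ge> 0" "\<And>j x. x \<in> A \<Longrightarrow> \<bar>divergence (\<phi> j) x\<bar> \<le> c j"
        by metis
      show ?thesis
      proof (rule that[of "\<Sum>j<n. c j"])
        show "(\<Sum>j<n. c j) \<ge> 0" by (simp add: sum_nonneg c(1))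
        fix j x assume "j < n" "x \<in> A"
        then show "\<bar>divergence (\<phi> j) x\<bar> \<le> (\<Sum>j<n. c j)"
          using member_le_sum[of j "{..<n}" c] c(1) c(2)[of x j] by force
      qed
    qed
    define \<eta> where "\<eta> = e / ((b + H) * V + 1)"
    have bHV: "(b + H) * V \<ge> 0" using b(1) H V0 by simp
    have "\<eta> > 0" unfolding \<eta>_def using bHV e by (simp add: add_nonneg_pos)
    have \<eta>e: "(b + H) * V * \<eta> \<le> e"
      unfolding \<eta>_def using bHV e by (simp add: field_simps)
    let ?good = "\<lambda>X R. C1 X \<and> (\<forall>z. norm (X z) \<le> 1) \<and>
      R \<in> sets borel \<and> emeasure lborel R < ennreal \<eta> \<and>
      (\<forall>t. t \<notin> R \<longrightarrow> (\<exists>j<n. t \<in> Aj j \<and> (\<forall>x. X (x, t) = \<phi> j x)) \<or>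
                      (t \<notin> (\<Union>j<n. Aj j) \<and> (\<forall>x. X (x, t) = 0))) \<and>
      (\<forall>t. \<forall>x\<in>A. \<bar>divergence (\<lambda>x. X (x, t)) x\<bar> \<le> b)"
    have "\<exists>X R. ?good X R"
      by (rule selected_test_fields[OF \<phi> bAj Ajb b(1) _ \<open>\<eta> > 0\<close>]) (rule b(2))
    then obtain X R where XR_all: "?good X R" by (elim exE)
    have X: "C1 X" "\<And>z. norm (X z) \<le> 1"
      and R[measurable]: "R \<in> sets borel" and Re: "emeasure lborel R < ennreal \<eta>"
      and XR_all': "\<forall>t. t \<notin> R \<longrightarrow> (\<exists>j<n. t \<in> Aj j \<and> (\<forall>x. X (x, t) = \<phi> j x)) \<or>
                    (t \<notin> (\<Union>j<n. Aj j) \<and> (\<forall>x. X (x, t) = 0))"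
      and Xb': "\<forall>t. \<forall>x\<in>A. \<bar>divergence (\<lambda>x. X (x, t)) x\<bar> \<le> b"
      using XR_all by - (elim conjE, (assumption | erule spec))+
    note XR = XR_all'[rule_format] and Xb = Xb'[rule_format]
    define \<Phi> where "\<Phi> z = (\<alpha> (snd z) *\<^sub>R X z, g (snd z))" for z
    have C\<Phi>: "C1 \<Phi>"
      unfolding \<Phi>_def by (intro C1_Pair C1_scaleR X C1_compose[OF C\<alpha> C1_snd] C1_compose[OF g(1) C1_snd])
    have n\<Phi>: "norm (\<Phi> z) \<le> 1" for z
    proof -
      have "norm (\<alpha> (snd z) *\<^sub>R X z) \<le> \<alpha> (snd z)"
        using X(2)[of z] \<alpha>01[of "snd z"] by (simp add: mult_left_le)
      then have "(norm (\<alpha> (snd z) *\<^sub>R X z))\<^sup>2 \<le> (\<alpha> (snd z))\<^sup>2"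
        by (intro power_mono) auto
      moreover have "(1 - s)\<^sup>2 + s \<le> (1::real)" if "0 \<le> s" "s \<le> 1/4" for s
      proof -
        have "s * s \<le> s * 1" by (rule mult_left_mono) (use that in auto)
        then show ?thesis by (simp add: power2_eq_square algebra_simps)
      qed
      then have "(\<alpha> (snd z))\<^sup>2 + (g (snd z))\<^sup>2 \<le> 1"
        unfolding \<alpha>_def using gsq[of "snd z"] by simp
      ultimately have "(norm (\<alpha> (snd z) *\<^sub>R X z))\<^sup>2 + (norm (g (snd z)))\<^sup>2 \<le> 1" by simp
      then show ?thesis unfolding \<Phi>_def norm_Pair by simp
    qed
    define dX where "dX t = (LINT x|lborel. indicator (fiber F t) x * divergence (\<lambda>x. X (x, t)) x)" for t
    have cX: "continuous_on UNIV (divergence (\<lambda>x. X (x, t)))" for t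
      by (rule continuous_on_divergence[OF C1_slice_fst[OF X(1)]])
    have iX: "integrable lborel (\<lambda>x. indicator (fiber F t) x * divergence (\<lambda>x. X (x, t)) x)" for t
      by (rule integrable_indicator_continuous[OF fb bf cX])
    have slice: "(LINT x|lborel. indicator (fiber F t) x * divergence \<Phi> (x, t)) = \<alpha> t * dX t + m t * deriv g t" for t
    proof -
      have "divergence \<Phi> (x, t) = \<alpha> t * divergence (\<lambda>x. X (x, t)) x + deriv g t" for x
        using divergence_prod[OF C\<Phi>, of x t] divergence_scaleR[OF C1_slice_fst[OF X(1)], of "\<alpha> t" t x]
        by (simp add: \<Phi>_def)
      then have "(LINT x|lborel. indicator (fiber F t) x * divergence \<Phi> (x, t))
        = (LINT x|lborel. \<alpha> t * (indicator (fiber F t) x * divergence (\<lambda>x. X (x, t)) x) + indicator (fiber F t) x * deriv g t)"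
        by (intro Bochner_Integration.integral_cong) (auto simp: algebra_simps)
      also have "\<dots> = \<alpha> t * dX t + m t * deriv g t"
        using iX fb ff by (subst Bochner_Integration.integral_add) (auto simp: dX_def m_def)
      finally show ?thesis .
    qed
    have cg: "continuous_on UNIV (\<lambda>z::'a \<times> real. deriv g (snd z))"
      by (rule continuous_on_compose2[OF C1_real_deriv(2)[OF g(1)]]) (auto intro: continuous_on_snd continuous_on_id)
    have img: "integrable lborel (\<lambda>t. m t * deriv g t)"
      using fubini_fibers(1)[OF bF F(1) cg] by (simp add: meq del: integral_mult_left_zero)
    have dXb: "\<bar>dX t\<bar> \<le> b * V" for t
    proof -
      have "\<bar>dX t\<bar> \<le> (LINT x|lborel. indicator (fiber F t) x * b)"
        unfolding dX_def
      proof (rule integral_abs_bound[THEN order_trans], rule integral_mono)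
        show "integrable lborel (\<lambda>x. \<bar>indicator (fiber F t) x * divergence (\<lambda>x. X (x, t)) x\<bar>)"
          using iX by (rule integrable_abs)
        show "integrable lborel (\<lambda>x. indicator (fiber F t) x * b)"
          using fb ff by simp
        show "\<bar>indicator (fiber F t) x * divergence (\<lambda>x. X (x, t)) x\<bar> \<le> indicator (fiber F t) x * b" for x
          using Xb[of x t] fA by (auto simp: indicator_def)
      qed
      also have "\<dots> \<le> b * V" unfolding meq using mult_right_mono[OF mV[of t] b(1)] by (simp add: mult.commute)
      finally show ?thesis .
    qed
    \<comment> \<open>The losses come from the transition zone \<open>Z\<close>, the times \<open>?W\<close> that the first \<open>n\<close> fields miss, and
      the exceptional set \<open>R\<close>, on which only the crude bound by \<open>b\<close> is available.\<close>
    let ?W = "T - (\<Union>j<n. Aj j)"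
    define lo where "lo t = H * m t - e * indicator {0<..<L} t - H * V * indicator Z t
      - H * V * indicator ?W t - (b + H) * V * indicator R t + m t * deriv g t" for t
    have lo: "lo t \<le> \<alpha> t * dX t + m t * deriv g t" if "t \<notin> N" for t
    proof -
      have HmV: "H * m t \<le> H * V" "H * V \<ge> 0" using H mV V0 by (auto intro: mult_left_mono)
      have nn: "e * indicator {0<..<L} t \<ge> 0" "H * V * indicator Z t \<ge> 0" "H * V * indicator ?W t \<ge> 0"
        "(b + H) * V * indicator R t \<ge> 0"
        using e H V0 b(1) by (auto simp: indicator_def)
      consider "t \<notin> {0<..<L}" | "t \<in> R" | "t \<in> {0<..<L}" "t \<notin> R" by blast
      then show ?thesis
      proof cases
        case 1
        then have "dX t = 0" "m t = 0" unfolding dX_def using f0 mo by auto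
        then show ?thesis using nn unfolding lo_def by simp
      next
        case 2
        have "\<bar>\<alpha> t * dX t\<bar> \<le> 1 * (b * V)"
          unfolding abs_mult using \<alpha>01[of t] dXb[of t] by (intro mult_mono) auto
        then have "\<alpha> t * dX t \<ge> - (b * V)" by simp
        then show ?thesis using nn 2 HmV unfolding lo_def by (simp add: algebra_simps)
      next
        case 3
        from XR[OF 3(2)] show ?thesis
        proof
          assume "\<exists>j<n. t \<in> Aj j \<and> (\<forall>x. X (x, t) = \<phi> j x)"
          then obtain j where j: "t \<in> Aj j" "\<And>x. X (x, t) = \<phi> j x" by blast
          then have "dX t = D j t" by (simp add: dX_def D_def)
          with j(1) have "\<alpha> t * dX t \<ge> H * m t - e" by (simp add: Aj_def)
          then show ?thesis using nn 3 unfolding lo_def by simp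
        next
          assume a: "t \<notin> (\<Union>j<n. Aj j) \<and> (\<forall>x. X (x, t) = 0)"
          then have "dX t = 0" by (simp add: dX_def divergence_const)
          moreover have "t \<in> Z \<or> t \<in> ?W"
            using a 3 that by (auto simp: T_def)
          then have "H * V * indicator Z t + H * V * indicator ?W t \<ge> H * m t"
            using HmV nn by (auto simp: indicator_def)
          ultimately show ?thesis using nn unfolding lo_def by simp
        qed
      qed
    qed
    have bI: "bounded {0<..<L}" by (rule bounded_subset[OF bounded_closed_interval[of 0 L]]) auto
    have fin: "emeasure lborel {0<..<L} < \<infinity>" "emeasure lborel Z < \<infinity>" "emeasure lborel ?W < \<infinity>" "emeasure lborel R < \<infinity>"
      using emeasure_bounded_finite[OF bI] emeasure_bounded_finite[OF bounded_closed_interval[of "c - e" "d + e"]]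
        less_trans[OF n ennreal_less_top] less_trans[OF Re ennreal_less_top]
      unfolding Z_def by (simp_all only: infinity_ennreal_def)
    have [measurable]: "Z \<in> sets borel" by (simp add: Z_def)
    have ilo: "integrable lborel lo"
      unfolding lo_def using fin im img
      by (intro Bochner_Integration.integrable_add Bochner_Integration.integrable_diff integrable_mult_right) auto
    have mW: "measure lborel ?W \<le> e" "measure lborel R \<le> \<eta>"
      unfolding measure_def using n Re e \<open>\<eta> > 0\<close> by (intro enn2real_leI; simp)+
    have mI: "measure lborel {0<..<L} = L" "measure lborel Z = 3 * e"
      using L e by (auto simp: Z_def dc)
    have gm: "(LINT t|lborel. m t * deriv g t) \<ge> \<delta> * (1/2 - e)"
    proof -
      have "integrable lborel (\<lambda>t. indicator (S \<inter> {c..<d}) t * deriv g t)"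
      proof (rule integrable_indicator_continuous)
        show "bounded (S \<inter> {c..<d})"
          by (rule bounded_subset[OF bounded_closed_interval[of c d]]) auto
      qed (use C1_real_deriv(2)[OF g(1)] in auto)
      then have i: "integrable lborel (\<lambda>t. \<delta> * (indicator (S \<inter> {c..<d}) t * deriv g t))" by simp
      have "\<delta> * (1/2 - e) \<le> \<delta> * (LINT t|lborel. indicator (S \<inter> {c..<d}) t * deriv g t)"
        using gS \<delta> by (intro mult_left_mono) auto
      also have "\<dots> = (LINT t|lborel. \<delta> * (indicator (S \<inter> {c..<d}) t * deriv g t))"
        by simp
      also have "\<dots> \<le> (LINT t|lborel. m t * deriv g t)"
      proof (rule integral_mono[OF i img])
        show "\<delta> * (indicator (S \<inter> {c..<d}) t * deriv g t) \<le> m t * deriv g t" for t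
          using g(4)[of t] m0[of t] by (auto simp: indicator_def S_def intro!: mult_right_mono)
      qed
      finally show ?thesis .
    qed
    have "(LINT t|lborel. lo t) = H * measure lborel F - e * L - H * V * (3 * e)
      - H * V * measure lborel ?W - (b + H) * V * measure lborel R + (LINT t|lborel. m t * deriv g t)"
    proof -
      have "(LINT t|lborel. lo t) = H * (LINT t|lborel. m t) - e * measure lborel {0<..<L} - H * V * measure lborel Z
        - H * V * measure lborel ?W - (b + H) * V * measure lborel R + (LINT t|lborel. m t * deriv g t)"
        unfolding lo_def using fin im img by simp
      then show ?thesis unfolding Fm mI .
    qed
    moreover have "(LINT t|lborel. lo t) \<le> p"
    proof -
      have "(LINT t|lborel. lo t) \<le> (LINT t|lborel. LINT x|lborel. indicator (fiber F t) x * divergence \<Phi> (x, t))"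
      proof (rule integral_mono_AE[OF ilo])
        show "integrable lborel (\<lambda>t. LINT x|lborel. indicator (fiber F t) x * divergence \<Phi> (x, t))"
          by (rule fubini_fibers(1)[OF bF F(1) continuous_on_divergence[OF C\<Phi>]])
        show "AE t in lborel. lo t \<le> (LINT x|lborel. indicator (fiber F t) x * divergence \<Phi> (x, t))"
          unfolding slice using AE_not_in[OF N0] by eventually_elim (rule lo)
      qed
      also have "\<dots> = (LINT z|lborel. indicator F z * divergence \<Phi> z)"
        by (rule fubini_fibers(2)[OF bF F(1) continuous_on_divergence[OF C\<Phi>], symmetric])
      also have "\<dots> \<le> 1 * p"
        by (rule perimeter_scaled_field[OF bF F(1) p _ C\<Phi> n\<Phi>]) simp
      finally show ?thesis by simp
    qed
    moreover have "H * V * measure lborel ?W \<le> H * V * e" "(b + H) * V * measure lborel R \<le> (b + H) * V * \<eta>"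
      using mW H V0 b(1) by (auto intro!: mult_left_mono)
    ultimately show ?thesis
      using gm \<eta>e by (simp add: algebra_simps)
  qed
  show ?thesis
  proof (rule ccontr)
    assume "\<not> ?thesis"
    then obtain p where p: "perimeter F \<le> ereal p" "p < H * measure lborel F + \<delta> / 2"
      unfolding not_le using ereal_dense2 less_ereal.simps(1) less_imp_le by metis
    define C where "C = \<delta> + L + 4 * H * V + 1"
    have "C > 0" unfolding C_def using \<delta> L H V0 by (simp add: add_nonneg_pos)
    have "H * measure lborel F + \<delta> / 2 \<le> p"
    proof (rule field_le_epsilon)
      fix e :: real assume "e > 0"
      then show "H * measure lborel F + \<delta> / 2 \<le> p + e"
        using almost[OF p(1), of "e / C"] \<open>C > 0\<close> by (simp add: C_def)
    qed
    with p(2) show False by simp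
  qed
qed

section \<open>Cheeger constants of cylinders\<close>

lemma content_cylinder:
  fixes E :: "'a::euclidean_space set"
  assumes "bounded E" "E \<in> sets borel" "L > 0"
  shows "E \<times> {0<..<L} \<in> sets borel" "measure lborel (E \<times> {0<..<L}) = L * measure lborel E"
proof -
  have "E \<times> {0<..<L} \<in> sets (lborel \<Otimes>\<^sub>M lborel)"
    using assms by (intro pair_measureI) auto
  then show "E \<times> {0<..<L} \<in> sets borel" unfolding lborel_prod by simp
  have "emeasure (lborel \<Otimes>\<^sub>M lborel) (E \<times> {0<..<L}) = emeasure lborel E * emeasure lborel {0<..<L}"
    by (rule lborel.emeasure_pair_measure_Times) (use assms in auto)
  then show "measure lborel (E \<times> {0<..<L}) = L * measure lborel E"
    unfolding lborel_prod measure_def using assms(3) by (simp add: enn2real_mult mult.commute)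
qed

text \<open>
  Integrated over each horizontal slice, the horizontal part of the divergence is at most \<open>p\<close>; over each
  vertical segment, the vertical part integrates to a difference of two values in \<open>[-1, 1]\<close>. The
  two terms are the lateral surface and the two caps.
\<close>

lemma perimeter_cylinder:
  fixes E :: "'a::euclidean_space set"
  assumes E: "bounded E" "E \<in> sets borel" and L: "L > 0" and p: "perimeter E \<le> ereal p"
  shows "perimeter (E \<times> {0<..<L}) \<le> ereal (L * p + 2 * measure lborel E)"
  unfolding perimeter_def
proof (rule SUP_least)
  fix \<phi> :: "'a \<times> real \<Rightarrow> 'a \<times> real"
  assume "\<phi> \<in> {\<phi>. C1_compact_support \<phi> \<and> (\<forall>x. norm (\<phi> x) \<le> 1)}"
  then have C: "C1 \<phi>" and \<phi>1: "\<And>z. norm (\<phi> z) \<le> 1" by (auto simp: C1_compact_support_iff)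
  let ?F = "E \<times> {0<..<L}"
  have bI: "bounded {0<..<L}" by (rule bounded_subset[OF bounded_closed_interval[of 0 L]]) auto
  have F: "bounded ?F" "?F \<in> sets borel"
    using bounded_Times[OF E(1) bI] content_cylinder(1)[OF E L] by auto
  have Ef: "emeasure lborel E < \<infinity>" by (rule emeasure_bounded_finite[OF E(1)])
  have p0: "p \<ge> 0" using p perimeter_nonneg[of E] by (metis ereal_less_eq(5) order_trans)
  define u where "u z = divergence (\<lambda>x. fst (\<phi> (x, snd z))) (fst z)" for z
  define w where "w z = deriv (\<lambda>t. snd (\<phi> (fst z, t))) (snd z)" for z
  have div: "divergence \<phi> z = u z + w z" for z
    using divergence_prod[OF C, of "fst z" "snd z"] by (simp add: u_def w_def)
  have Ch: "C1 (\<lambda>x. fst (\<phi> (x, t)))" and Cv: "C1 (\<lambda>t. snd (\<phi> (x, t)))" for x t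
    using C1_compose[OF C1_fst C1_slice_fst[OF C]] C1_compose[OF C1_snd C1_slice_snd[OF C]] by auto
  have weq: "w z = snd (frechet_derivative \<phi> (at z) (0, 1))" for z
    using deriv_snd_component[OF C, of "fst z" "snd z"] by (simp add: w_def)
  have cw: "continuous_on UNIV w"
    unfolding weq[abs_def] by (intro continuous_on_snd C1_frechet(2)[OF C])
  have cu: "continuous_on UNIV u"
  proof -
    have "u = (\<lambda>z. divergence \<phi> z - w z)" using div by auto
    then show ?thesis using continuous_on_diff[OF continuous_on_divergence[OF C] cw] by simp
  qed
  have iu: "integrable lborel (\<lambda>z. indicator ?F z * u z)" and iw: "integrable lborel (\<lambda>z. indicator ?F z * w z)"
    using F cu cw by (auto intro: integrable_indicator_continuous)
  have f: "fiber ?F t = (if t \<in> {0<..<L} then E else {})" for t by (auto simp: fiber_def)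
  have "(LINT z|lborel. indicator ?F z * u z) = (LINT t|lborel. LINT x|lborel. indicator (fiber ?F t) x * u (x, t))"
    by (rule fubini_fibers(2)[OF F cu])
  also have "\<dots> \<le> (LINT t|lborel. indicator {0<..<L} t * p)"
  proof (rule integral_mono[OF fubini_fibers(1)[OF F cu]])
    show "integrable lborel (\<lambda>t. indicator {0<..<L} t * p)"
      by (intro integrable_indicator_continuous bI continuous_on_const) simp
    fix t
    have "(LINT x|lborel. indicator E x * u (x, t)) \<le> 1 * p"
      unfolding u_def fst_conv snd_conv
    proof (rule perimeter_scaled_field[OF E p _ Ch])
      show "norm (fst (\<phi> (x, t))) \<le> 1" for x
        using norm_fst_le[of "fst (\<phi> (x, t))" "snd (\<phi> (x, t))"] \<phi>1[of "(x, t)"] by simp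
    qed simp
    then show "(LINT x|lborel. indicator (fiber ?F t) x * u (x, t)) \<le> indicator {0<..<L} t * p"
      unfolding f by auto
  qed
  also have "\<dots> = L * p" using L by simp
  finally have 1: "(LINT z|lborel. indicator ?F z * u z) \<le> L * p" .
  have iw': "integrable (lborel \<Otimes>\<^sub>M lborel) (\<lambda>(x, t). indicator ?F (x, t) * w (x, t))"
    unfolding lborel_prod using iw by (simp add: case_prod_unfold)
  have "(LINT z|lborel. indicator ?F z * w z) = (LINT x|lborel. LINT t|lborel. indicator ?F (x, t) * w (x, t))"
    using lborel_pair.integral_fst[OF iw'] unfolding lborel_prod by (simp add: case_prod_unfold)
  also have "\<dots> \<le> (LINT x|lborel. indicator E x * 2)"
  proof (rule integral_mono[OF lborel_pair.integrable_fst[OF iw']])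
    show "integrable lborel (\<lambda>x. indicator E x * 2 :: real)" using E(2) Ef by simp
    fix x
    define h where "h t = snd (\<phi> (x, t))" for t
    have h: "C1 h" unfolding h_def by (rule Cv)
    have h1: "\<bar>h t\<bar> \<le> 1" for t
      using norm_snd_le[of "snd (\<phi> (x, t))" "fst (\<phi> (x, t))"] \<phi>1[of "(x, t)"] by (simp add: h_def)
    have "(LINT t|lborel. indicator {0<..<L} t * deriv h t) = (LINT t|lborel. deriv h t * indicator {0..L} t)"
    proof (rule integral_cong_AE)
      have [measurable]: "deriv h \<in> borel_measurable borel"
        by (rule borel_measurable_continuous_onI[OF C1_real_deriv(2)[OF h]])
      show "(\<lambda>t. indicator {0<..<L} t * deriv h t) \<in> borel_measurable lborel"
        "(\<lambda>t. deriv h t * indicator {0..L} t) \<in> borel_measurable lborel" by measurable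
      have "{0, L} \<in> null_sets lborel" by (intro finite_imp_null_set_lborel) auto
      from AE_not_in[OF this]
      show "AE t in lborel. indicator {0<..<L} t * deriv h t = deriv h t * indicator {0..L} t"
        by eventually_elim (auto simp: indicator_def)
    qed
    also have "\<dots> = h L - h 0"
    proof (rule integral_FTC_Icc_real)
      show "isCont (deriv h) t" for t
        using C1_real_deriv(2)[OF h] by (simp add: continuous_on_eq_continuous_at)
    qed (use L C1_real_deriv(1)[OF h] in auto)
    also have "\<dots> \<le> 2" using h1[of L] h1[of 0] by linarith
    finally show "(LINT t|lborel. indicator ?F (x, t) * w (x, t)) \<le> indicator E x * 2"
      unfolding w_def h_def[symmetric] fst_conv snd_conv
      by (cases "x \<in> E") (simp_all add: indicator_times h_def[abs_def])
  qed
  also have "\<dots> = 2 * measure lborel E" using E(2) Ef by simp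
  finally have 2: "(LINT z|lborel. indicator ?F z * w z) \<le> 2 * measure lborel E" .
  have "(LINT z:?F|lebesgue. divergence \<phi> z) = (LINT z|lborel. indicator ?F z * divergence \<phi> z)"
    by (intro set_lint_lebesgue_eq_lborel F borel_measurable_continuous_onI continuous_on_divergence C)
  also have "\<dots> = (LINT z|lborel. indicator ?F z * u z + indicator ?F z * w z)"
    by (simp add: div algebra_simps)
  also have "\<dots> = (LINT z|lborel. indicator ?F z * u z) + (LINT z|lborel. indicator ?F z * w z)"
    by (rule Bochner_Integration.integral_add[OF iu iw])
  finally show "ereal (LINT z:?F|lebesgue. divergence \<phi> z) \<le> ereal (L * p + 2 * measure lborel E)"
    using 1 2 by simp
qed

lemma cheeger_le:
  assumes "E \<subseteq> A" "E \<in> sets borel" "measure lborel E > 0"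
  shows "cheeger A \<le> perimeter E / ereal (measure lborel E)"
proof -
  have "cheeger A \<le> perimeter E / ereal (measure lebesgue E)"
    unfolding cheeger_def by (rule INF_lower) (use assms measure_lebesgue_borel in auto)
  then show ?thesis by (simp add: measure_lebesgue_borel assms)
qed

lemma le_cheegerI:
  assumes "\<And>E. E \<subseteq> A \<Longrightarrow> E \<in> sets borel \<Longrightarrow> measure lborel E > 0 \<Longrightarrow>
    C \<le> perimeter E / ereal (measure lborel E)"
  shows "C \<le> cheeger A"
  unfolding cheeger_def
proof (rule INF_greatest)
  fix E assume E: "E \<in> {E. E \<subseteq> A \<and> E \<in> sets lebesgue \<and> 0 < measure lebesgue E}"
  then obtain E0 where "E0 \<in> sets borel" "E0 \<subseteq> E" "measure lebesgue E = measure lborel E0"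
    "perimeter E = perimeter E0"
    using borel_kernel[of E] by auto
  then show "C \<le> perimeter E / ereal (measure lebesgue E)"
    using assms[of E0] E by auto
qed

lemma cheeger_nonneg: "0 \<le> cheeger A"
  by (rule le_cheegerI) (simp add: perimeter_nonneg)

lemma cheeger_cylinder_le:
  fixes \<Omega> :: "'a::euclidean_space set"
  assumes "bounded \<Omega>" "L > 0"
  shows "cheeger (\<Omega> \<times> {0<..<L}) \<le> cheeger \<Omega> + ereal (2 / L)"
proof -
  have "cheeger (\<Omega> \<times> {0<..<L}) - ereal (2 / L) \<le> cheeger \<Omega>"
  proof (rule le_cheegerI)
    fix E assume E: "E \<subseteq> \<Omega>" "E \<in> sets borel" "measure lborel E > 0"
    have bE: "bounded E" using E(1) assms(1) bounded_subset by blast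
    let ?m = "measure lborel E"
    show "cheeger (\<Omega> \<times> {0<..<L}) - ereal (2 / L) \<le> perimeter E / ereal ?m"
    proof (cases "perimeter E")
      case (real p)
      have "cheeger (\<Omega> \<times> {0<..<L}) \<le> perimeter (E \<times> {0<..<L}) / ereal (L * ?m)"
        using cheeger_le[of "E \<times> {0<..<L}" "\<Omega> \<times> {0<..<L}"] content_cylinder[OF bE E(2) assms(2)] E assms(2)
        by auto
      also have "\<dots> \<le> ereal (L * p + 2 * ?m) / ereal (L * ?m)"
        by (rule ereal_divide_right_mono) (use perimeter_cylinder[OF bE E(2) assms(2), of p] real E(3) assms(2) in auto)
      also have "\<dots> = ereal (p / ?m + 2 / L)"
        using E(3) assms(2) by (simp add: field_simps)
      finally show ?thesis
        using real E(3) by (simp add: ereal_minus_le)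
    next
      case PInf
      then show ?thesis using E(3) by simp
    next
      case MInf
      then show ?thesis using perimeter_nonneg[of E] by simp
    qed
  qed
  then show ?thesis by (simp add: ereal_minus_le)
qed

text \<open>
  A real number \<open>H\<close> in place of \<open>h(\<Omega>)\<close> lets the statement be used without first knowing that \<open>h(\<Omega>)\<close>
  is finite. The fibres of \<open>F\<close> have average measure \<open>\<bar>F\<bar> / L\<close>, so they exceed half of it on a set of
  positive measure; hence the gain \<open>\<delta>' / 2\<close> of the fibre estimate is available with \<open>\<delta>'\<close> the minimum of
  \<open>\<delta>\<close> and \<open>\<bar>F\<bar> / (2 L)\<close>. Dividing by \<open>\<bar>F\<bar> \<le> V L\<close> leaves at least \<open>c / L\<close>, where \<open>V\<close> bounds the
  measure of \<open>\<Omega>\<close>.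
\<close>

lemma cheeger_cylinder_ge:
  fixes \<Omega> :: "'a::euclidean_space set"
  assumes \<Omega>: "bounded \<Omega>" and H: "H \<ge> 0" "ereal H \<le> cheeger \<Omega>"
  shows "\<exists>c>0. \<forall>L>0. ereal (H + c / L) \<le> cheeger (\<Omega> \<times> {0<..<L})"
proof -
  obtain \<delta> where \<delta>: "\<delta> > 0" and \<delta>P: "\<And>E::'a set. bounded E \<Longrightarrow> E \<in> sets borel \<Longrightarrow>
    measure lborel E \<le> \<delta> \<Longrightarrow> ereal ((2 * H + 1) * measure lborel E) \<le> perimeter E"
    using small_sets_large_perimeter[of "2 * H + 1"] H(1) by auto
  have PA: "ereal (H * measure lborel E) \<le> perimeter E" if E: "E \<subseteq> \<Omega>" "E \<in> sets borel" for E
  proof (cases "measure lborel E > 0")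
    case True
    have "ereal H \<le> perimeter E / ereal (measure lborel E)"
      using H(2) cheeger_le[OF E True] by (rule order_trans)
    then show ?thesis using True by (cases "perimeter E") (auto simp: field_simps)
  next
    case False
    then show ?thesis using perimeter_nonneg[of E] measure_nonneg[of lborel E] by (simp add: less_le zero_ereal_def)
  qed
  have P\<delta>: "ereal (2 * H * measure lborel E) \<le> perimeter E"
    if E: "E \<subseteq> \<Omega>" "E \<in> sets borel" "measure lborel E \<le> \<delta>" for E
  proof -
    have "ereal (2 * H * measure lborel E) \<le> ereal ((2 * H + 1) * measure lborel E)"
      by (simp add: mult_right_mono)
    also have "\<dots> \<le> perimeter E" by (rule \<delta>P) (use E \<Omega> bounded_subset in auto)
    finally show ?thesis .
  qed
  obtain r where r: "r > 0" "\<Omega> \<subseteq> ball 0 r" using \<Omega> bounded_subset_ballD by blast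
  define V where "V = measure lborel (ball (0::'a) r)"
  have V: "V > 0" unfolding V_def using content_ball_pos[OF r(1)] by simp
  define c where "c = min (\<delta> / V) (1/2) / 2"
  have c: "c > 0" unfolding c_def using \<delta> V by simp
  have "ereal (H + c / L) \<le> cheeger (\<Omega> \<times> {0<..<L})" if L: "L > 0" for L
  proof (rule le_cheegerI)
    fix F assume F: "F \<subseteq> \<Omega> \<times> {0<..<L}" "F \<in> sets borel" "measure lborel F > 0"
    let ?m = "\<lambda>t. measure lborel (fiber F t)"
    define M where "M = measure lborel F"
    have "M > 0" using F(3) by (simp add: M_def)
    have bI: "bounded {0<..<L}" by (rule bounded_subset[OF bounded_closed_interval[of 0 L]]) auto
    have iI: "integrable lborel (\<lambda>t. indicator {0<..<L} t * v)" for v :: real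
      by (intro integrable_indicator_continuous bI continuous_on_const) simp
    have bF: "bounded F" by (rule bounded_subset[OF bounded_Times[OF \<Omega> bI] F(1)])
    have im: "integrable lborel ?m" and Mm: "M = (LINT t|lborel. ?m t)"
      using fubini_fibers[OF bF F(2), of "\<lambda>_. 1"] F(2) by (simp_all add: fiber_borel M_def)
    have mo: "?m t = 0" if "t \<notin> {0<..<L}" for t
    proof -
      have "fiber F t = {}" using F(1) that by (auto simp: fiber_def)
      then show ?thesis by simp
    qed
    have mV: "?m t \<le> V" for t
    proof -
      have "fiber F t \<subseteq> ball 0 r" using F(1) r(2) by (auto simp: fiber_def)
      then show ?thesis
        unfolding V_def using emeasure_bounded_finite[OF bounded_ball, of "0::'a" r] fiber_borel[OF F(2)]
        by (intro measure_mono_fmeasurable) (auto simp: fmeasurable_def)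
    qed
    have MV: "M \<le> V * L"
    proof -
      have "M \<le> (LINT t|lborel. indicator {0<..<L} t * V)"
        unfolding Mm
      proof (rule integral_mono[OF im])
        show "integrable lborel (\<lambda>t. indicator {0<..<L} t * V)" by (rule iI)
        show "?m t \<le> indicator {0<..<L} t * V" for t
          using mV[of t] mo[of t] by (cases "t \<in> {0<..<L}") (simp_all add: indicator_def)
      qed
      then show ?thesis using L by (simp add: mult.commute)
    qed
    define \<delta>' where "\<delta>' = min \<delta> (M / L / 2)"
    have \<delta>': "\<delta>' > 0" "\<delta>' \<le> \<delta>" "\<delta>' \<le> M / L / 2"
      unfolding \<delta>'_def using \<delta> \<open>M > 0\<close> L by auto
    have S: "emeasure lborel {t. \<delta>' < ?m t} > 0"
    proof (rule ccontr)
      assume "\<not> ?thesis"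
      moreover have "{t. \<delta>' < ?m t} \<in> sets lborel"
        using im by measurable
      ultimately have "{t. \<delta>' < ?m t} \<in> null_sets lborel" by (auto simp: null_sets_def)
      from AE_not_in[OF this] have "AE t in lborel. ?m t \<le> indicator {0<..<L} t * \<delta>'"
        by eventually_elim (use mo in \<open>auto simp: indicator_def\<close>)
      then have "M \<le> (LINT t|lborel. indicator {0<..<L} t * \<delta>')"
        unfolding Mm by (rule integral_mono_AE[OF im iI])
      also have "\<dots> = L * \<delta>'" using L by simp
      also have "\<dots> \<le> L * (M / L / 2)" using \<delta>'(3) L by (intro mult_left_mono) auto
      also have "\<dots> = M / 2" using L by simp
      finally show False using \<open>M > 0\<close> by simp
    qed
    have "ereal (H * M + \<delta>' / 2) \<le> perimeter F"
      unfolding M_def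
      by (rule perimeter_lower_bound_by_fibers[OF \<Omega> F(2,1) L H(1) PA P\<delta> less_imp_le[OF \<delta>'(1)] S])
        (use \<delta>'(2) in auto)
    moreover have "(H + c / L) * M \<le> H * M + \<delta>' / 2"
    proof -
      have "c / L * M \<le> \<delta> / 2"
      proof -
        have "c / L * M \<le> c / L * (V * L)" using MV c L by (intro mult_left_mono) auto
        also have "\<dots> = c * V" using L by simp
        also have "\<dots> \<le> (\<delta> / V / 2) * V" using V by (intro mult_right_mono) (auto simp: c_def)
        finally show ?thesis using V by simp
      qed
      moreover have "c / L * M \<le> M / L / 2 / 2"
      proof -
        have "c * (M / L) \<le> (1/2) / 2 * (M / L)"
          using \<open>M > 0\<close> L by (intro mult_right_mono) (auto simp: c_def)
        then show ?thesis by simp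
      qed
      ultimately have "c / L * M \<le> \<delta>' / 2" by (auto simp: \<delta>'_def min_def)
      then show ?thesis by (simp add: distrib_right)
    qed
    ultimately have "ereal ((H + c / L) * M) \<le> perimeter F"
      by (meson ereal_less_eq(3) order_trans)
    then show "ereal (H + c / L) \<le> perimeter F / ereal (measure lborel F)"
      using \<open>M > 0\<close> unfolding M_def[symmetric] by (cases "perimeter F") (auto simp: field_simps)
  qed
  with c show ?thesis by blast
qed

theorem theorem2p1:
  fixes \<Omega> :: "(real ^ 'n) set"
  assumes "\<Omega> \<noteq> {}" and "open \<Omega>" and "bounded \<Omega>"
  shows "\<exists>c::real. c > 0 \<and>
    (\<forall>L::real. L \<ge> 1 \<longrightarrow>
      cheeger \<Omega> + ereal (c / L) \<le> cheeger (\<Omega> \<times> {0<..<L}) \<and>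
      cheeger (\<Omega> \<times> {0<..<L}) \<le> cheeger \<Omega> + ereal (2 / L))"
proof (cases "cheeger \<Omega>")
  case (real H)
  then have "H \<ge> 0" using cheeger_nonneg[of \<Omega>] by simp
  then obtain c where "c > 0" "\<And>L. L > 0 \<Longrightarrow> ereal (H + c / L) \<le> cheeger (\<Omega> \<times> {0<..<L})"
    using cheeger_cylinder_ge[OF assms(3), of H] real by auto
  then show ?thesis
    using cheeger_cylinder_le[OF assms(3)] real by (intro exI[of _ c]) auto
next
  case PInf
  \<comment> \<open>Every real number is a lower bound for the Cheeger constant of the cylinder, too.\<close>
  have "cheeger (\<Omega> \<times> {0<..<L}) = \<infinity>" if L: "L > 0" for L :: real
  proof (rule ereal_top)
    fix B :: real
    obtain c where "c > 0" "ereal (max 0 B + c / L) \<le> cheeger (\<Omega> \<times> {0<..<L})"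
      using cheeger_cylinder_ge[OF assms(3), of "max 0 B"] PInf L by auto
    moreover have "ereal B \<le> ereal (max 0 B + c / L)"
      using \<open>c > 0\<close> L by (simp add: add_increasing2 max.coboundedI2)
    ultimately show "ereal B \<le> cheeger (\<Omega> \<times> {0<..<L})" by (meson order_trans)
  qed
  then show ?thesis using PInf by (intro exI[of _ 1]) auto
next
  case MInf
  then show ?thesis using cheeger_nonneg[of \<Omega>] by simp
qed

end
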